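(* Let $\mathbb F_q$ be a finite field, $\mathbf w=(w_0,\dots,w_n)$ a vector of positive integers, and $\mathcal P_{\mathbf w}=[(\mathbb A^{n+1}\setminus\{0\})/\mathbb G_m]$ the weighted projective stack over $\mathbb F_q$. The stacky mass of $\mathcal P_{\mathbf w}(\mathbb F_q)$ equals the coarse point count: $$\sum_{[x]\in\pi_0(\mathcal P_{\mathbf w}(\mathbb F_q))}\frac1{\#\operatorname{Aut}(x)(\mathbb F_q)}=\#\mathbb P^n_{\mathbf w}(\mathbb F_q)=\frac{q^{n+1}-1}{q-1}.$$ In particular the mass does not depend on the weights $\mathbf w$ (only on $n$ and $q$); among the coarse count, the mass and the orbit count $A_{\mathbf w}(q)$, only $A_{\mathbf w}(q)$ is sensitive to the weights.
   Context: $\mathbb G_m$ acts on $\mathbb A^{n+1}\setminus\{0\}$ by $\lambda\cdot(x_0,\dots,x_n)=(\lambda^{w_0}x_0,\dots,\lambda^{w_n}x_n)$. $\pi_0(\mathcal P_{\mathbf w}(\mathbb F_q))$ is the set of isomorphism classes of the groupoid $\mathcal P_{\mathbf w}(\mathbb F_q)$, and $\operatorname{Aut}(x)$ is the automorphism group scheme of the object $x$. $\mathbb P^n_{\mathbf w}=\operatorname{Proj}\mathbb F_q[x_0,\dots,x_n]$ with $\deg x_i=w_i$ is the coarse weighted projective space. $A_{\mathbf w}(q)$ is the number of $\mathbb F_q^\times$-orbits on $\mathbb F_q^{n+1}\setminus\{0\}$ under the weighted action.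
   Formalization: The claim that the orbit count A_w(q) is sensitive to the weights is stated for q > 2 only: for q = 2 the group F_2^× is trivial, so A_2 count is 2^{n+1}-1 for every weight vector w and the claim fails there. *)

theory Defs
  imports
    "HOL-Algebra.Algebraic_Closure_Type"
    "HOL-Algebra.Group_Action"
    "HOL-Library.Cardinality"
    "HOL-Library.Poly_Mapping"
begin

text \<open>
  Conventions. The finite field is a type \<open>'a\<close> of sort \<open>{field, finite}\<close>, and
  \<open>'a alg_closure\<close> is its algebraic closure. The coordinates
  \<open>x\<^sub>0, \<dots>, x\<^sub>n\<close> are indexed by a finite type \<open>'n\<close> with \<open>n + 1\<close> elements, so a weight
  vector is a function \<open>w :: 'n \<Rightarrow> nat\<close>, and a point of affine space with coordinates in \<open>'b\<close>
  is a function \<open>'n \<Rightarrow> 'b\<close>.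
\<close>

section \<open>The weighted action\<close>

abbreviation Gm :: "'b::field monoid" where
  "Gm \<equiv> units_of ring_of_type_algebra"

definition punctured_affine :: "('n \<Rightarrow> 'b::field) set" where
  "punctured_affine = {x. \<exists>i. x i \<noteq> 0}"

definition weighted_act :: "('n \<Rightarrow> nat) \<Rightarrow> 'b::field \<Rightarrow> ('n \<Rightarrow> 'b) \<Rightarrow> 'n \<Rightarrow> 'b" where
  "weighted_act w l x = (\<lambda>i. l ^ w i * x i)"

definition orbit_count :: "'a::field itself \<Rightarrow> ('n \<Rightarrow> nat) \<Rightarrow> nat" where
  "orbit_count _ w =
     card (orbits Gm (punctured_affine :: ('n \<Rightarrow> 'a) set) (weighted_act w))"


section \<open>The groupoid of rational points of the weighted projective stack\<close>

definition galois_group :: "('a::field alg_closure \<Rightarrow> 'a alg_closure) monoid" where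
  "galois_group =
     \<lparr>carrier = {s \<in> ring_iso ring_of_type_algebra ring_of_type_algebra.
                  \<forall>c. s (to_ac c) = to_ac c},
      monoid.mult = (\<circ>), one = id\<rparr>"

text \<open>
  A \<open>\<bbbG>\<^sub>m\<close>-torsor over a perfect field \<open>k\<close> is an etale sheaf on \<open>Spec k\<close> that is a torsor under
  \<open>\<bbbG>\<^sub>m\<close>. Etale sheaves on \<open>Spec k\<close> are sets with a continuous action of the absolute Galois group
  (the stalk at the geometric point), and \<open>\<bbbG>\<^sub>m\<close> is the group of units of the closure with its
  Galois action. The last clause of \<open>is_torsor\<close> is continuity: every stabilizer contains the
  subgroup fixing some finite set of elements of the closure. No rational point is assumed.
  The actions are actions on \<open>geom_points\<close> in the sense of \<open>group_action\<close>; the value of \<open>tact T 0\<close>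
  is irrelevant.
\<close>

record ('l, 'u) torsor =
  geom_points :: "'u set"
  tact :: "'l \<Rightarrow> 'u \<Rightarrow> 'u"
  tgal :: "('l \<Rightarrow> 'l) \<Rightarrow> 'u \<Rightarrow> 'u"

definition is_torsor :: "('a::field alg_closure, 'u) torsor \<Rightarrow> bool" where
  "is_torsor T \<longleftrightarrow>
     geom_points T \<noteq> {} \<and>
     group_action Gm (geom_points T) (tact T) \<and>
     (\<forall>p\<in>geom_points T. \<forall>p'\<in>geom_points T. \<exists>!l. l \<in> carrier Gm \<and> tact T l p = p') \<and>
     group_action galois_group (geom_points T) (tgal T) \<and>
     (\<forall>s\<in>carrier galois_group. \<forall>l\<in>carrier Gm. \<forall>p\<in>geom_points T.
        tgal T s (tact T l p) = tact T (s l) (tgal T s p)) \<and>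
     (\<forall>p\<in>geom_points T. \<exists>F. finite F \<and>
        (\<forall>s\<in>carrier galois_group. (\<forall>a\<in>F. s a = a) \<longrightarrow> tgal T s p = p))"

text \<open>
  By definition of the quotient stack, an object over \<open>k\<close> is a torsor together with an equivariant
  map to the punctured affine space (compatible with the Galois actions, that is, defined over
  \<open>k\<close>; an equivariant map is automatically algebraic). Torsors have their geometric points in an
  arbitrary type \<open>'u\<close>, which serves as the universe and must be large enough to contain a copy
  of the multiplicative group of the closure.
\<close>

type_synonym ('a, 'n, 'u) stack_object = "('a alg_closure, 'u) torsor \<times> ('u \<Rightarrow> 'n \<Rightarrow> 'a alg_closure)"

definition stack_objects :: "('n \<Rightarrow> nat) \<Rightarrow> ('a::field, 'n, 'u) stack_object set" where
  "stack_objects w = {(T, f). is_torsor T \<and>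
     (\<forall>p\<in>geom_points T. f p \<in> punctured_affine \<and>
        (\<forall>l\<in>carrier Gm. f (tact T l p) = weighted_act w l (f p)) \<and>
        (\<forall>s\<in>carrier galois_group. f (tgal T s p) = s \<circ> f p))}"

text \<open>Every morphism is invertible, because an equivariant map of torsors is bijective.\<close>

fun stack_hom ::
  "('a::field, 'n, 'u) stack_object \<Rightarrow> ('a, 'n, 'u) stack_object \<Rightarrow> ('u \<Rightarrow> 'u) set" where
  "stack_hom (T, f) (T', f') = {h \<in> geom_points T \<rightarrow>\<^sub>E geom_points T'.
     \<forall>p\<in>geom_points T. f' (h p) = f p \<and>
        (\<forall>l\<in>carrier Gm. h (tact T l p) = tact T' l (h p)) \<and>
        (\<forall>s\<in>carrier galois_group. h (tgal T s p) = tgal T' s (h p))}"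

text \<open>The rational points of the automorphism group scheme of \<open>x\<close> are the automorphisms of \<open>x\<close>
  in the groupoid of rational points.\<close>

abbreviation stack_aut :: "('a::field, 'n, 'u) stack_object \<Rightarrow> ('u \<Rightarrow> 'u) set" where
  "stack_aut x \<equiv> stack_hom x x"

definition stack_pi0 :: "('n \<Rightarrow> nat) \<Rightarrow> ('a::field, 'n, 'u) stack_object set set" where
  "stack_pi0 w = stack_objects w //
     {(x, y). x \<in> stack_objects w \<and> y \<in> stack_objects w \<and> stack_hom x y \<noteq> {}}"

definition stacky_mass :: "'u itself \<Rightarrow> 'a::field itself \<Rightarrow> ('n \<Rightarrow> nat) \<Rightarrow> real" where
  "stacky_mass _ _ w =
     (\<Sum>C\<in>(stack_pi0 w :: ('a, 'n, 'u) stack_object set set).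
        1 / real (card (stack_aut (SOME x. x \<in> C))))"


section \<open>Rational points of the coarse weighted projective space\<close>

text \<open>The polynomial ring in the variables indexed by \<open>'n\<close>: finitely supported functions from
  exponent vectors to coefficients, with the convolution product.\<close>

type_synonym ('a, 'n) multipoly = "('n \<Rightarrow>\<^sub>0 nat) \<Rightarrow>\<^sub>0 'a"

definition wdeg :: "('n::finite \<Rightarrow> nat) \<Rightarrow> ('n \<Rightarrow>\<^sub>0 nat) \<Rightarrow> nat" where
  "wdeg w m = (\<Sum>i\<in>UNIV. w i * Poly_Mapping.lookup m i)"

definition homogeneous :: "('n::finite \<Rightarrow> nat) \<Rightarrow> nat \<Rightarrow> ('a::field, 'n) multipoly \<Rightarrow> bool" where
  "homogeneous w d f \<longleftrightarrow> (\<forall>m\<in>Poly_Mapping.keys f. wdeg w m = d)"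

definition hom_component ::
  "('n::finite \<Rightarrow> nat) \<Rightarrow> nat \<Rightarrow> ('a::field, 'n) multipoly \<Rightarrow> ('a, 'n) multipoly" where
  "hom_component w d f =
     (\<Sum>m\<in>{m\<in>Poly_Mapping.keys f. wdeg w m = d}. Poly_Mapping.single m (Poly_Mapping.lookup f m))"

definition irrelevant_ideal :: "('n::finite \<Rightarrow> nat) \<Rightarrow> ('a::field, 'n) multipoly set" where
  "irrelevant_ideal w = {f. hom_component w 0 f = 0}"

definition Proj :: "('n::finite \<Rightarrow> nat) \<Rightarrow> ('a::field, 'n) multipoly set set" where
  "Proj w = {P. primeideal P ring_of_type_algebra \<and>
     (\<forall>f\<in>P. \<forall>d. hom_component w d f \<in> P) \<and>
     \<not> irrelevant_ideal w \<subseteq> P}"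

text \<open>
  The local ring of \<open>Proj\<close> at \<open>P\<close> consists of the fractions \<open>f / g\<close> with \<open>f\<close>, \<open>g\<close> homogeneous of the
  same degree and \<open>g \<notin> P\<close>, and its maximal ideal of those with \<open>f \<in> P\<close>. As \<open>P\<close> is prime,
  \<open>f / g\<close> and \<open>f' / g'\<close> agree in the residue field iff \<open>f * g' - f' * g \<in> P\<close>.
\<close>

definition hom_fractions ::
  "('n::finite \<Rightarrow> nat) \<Rightarrow> ('a::field, 'n) multipoly set
     \<Rightarrow> (('a, 'n) multipoly \<times> ('a, 'n) multipoly) set" where
  "hom_fractions w P = {(f, g). \<exists>d. homogeneous w d f \<and> homogeneous w d g \<and> g \<notin> P}"

definition residue_rel ::
  "('n::finite \<Rightarrow> nat) \<Rightarrow> ('a::field, 'n) multipoly set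
     \<Rightarrow> (('a, 'n) multipoly \<times> ('a, 'n) multipoly) rel" where
  "residue_rel w P = {((f, g), (f', g')).
     (f, g) \<in> hom_fractions w P \<and> (f', g') \<in> hom_fractions w P \<and> f * g' - f' * g \<in> P}"

definition residue_field ::
  "('n::finite \<Rightarrow> nat) \<Rightarrow> ('a::field, 'n) multipoly set
     \<Rightarrow> (('a, 'n) multipoly \<times> ('a, 'n) multipoly) set set" where
  "residue_field w P = hom_fractions w P // residue_rel w P"

definition residue_const ::
  "('n::finite \<Rightarrow> nat) \<Rightarrow> ('a::field, 'n) multipoly set
     \<Rightarrow> 'a \<Rightarrow> (('a, 'n) multipoly \<times> ('a, 'n) multipoly) set" where
  "residue_const w P c = residue_rel w P `` {(Poly_Mapping.single 0 c, 1)}"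

text \<open>A morphism \<open>Spec k \<rightarrow> Proj\<close> over \<open>k\<close> is a point together with a \<open>k\<close>-algebra homomorphism from
  its residue field to \<open>k\<close>. The homomorphism exists iff the structure map from \<open>k\<close> to the residue
  field is bijective, and it is then unique.\<close>

definition Proj_rational_points ::
  "('n::finite \<Rightarrow> nat) \<Rightarrow> ('a::field, 'n) multipoly set set" where
  "Proj_rational_points w =
     {P \<in> Proj w. bij_betw (residue_const w P) UNIV (residue_field w P)}"

definition coarse_count :: "'a::field itself \<Rightarrow> ('n::finite \<Rightarrow> nat) \<Rightarrow> nat" where
  "coarse_count _ w = card (Proj_rational_points w :: ('a, 'n) multipoly set set)"

end

theory Submission
  imports Defs
begin

text \<open>
  By Lang's argument every torsor over \<open>\<bbbF>\<^sub>q\<close> has a rational point, so an object of the groupoid is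
  determined up to isomorphism by an \<open>\<bbbF>\<^sub>q\<^sup>\<times>\<close>-orbit of nonzero vectors over \<open>\<bbbF>\<^sub>q\<close>, with the stabilizer
  as automorphism group. By orbit-stabilizer the mass is the number of nonzero vectors divided by
  \<open>q - 1\<close>.

  On the coarse side every nonzero vector \<open>x\<close> defines a rational point of \<open>Proj\<close>, and every rational point
  arises. If \<open>d\<close> is the greatest common divisor of the weights in the support of \<open>x\<close>, the vectors
  defining the same point are the \<open>q - 1\<close> vectors \<open>(t ^ (w\<^sub>i / d) x\<^sub>i)\<close> with \<open>t \<noteq> 0\<close>, which gives
  the same count.

  The orbit count changes between the weights \<open>1\<close> and the weights \<open>q - 1\<close>, where the action is
  trivial.
\<close>

section \<open>The Galois group of a finite field\<close>

text \<open>Lang's argument produces a point fixed by Frobenius, while rationality asks for a point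
  fixed by the whole Galois group, in which the powers of Frobenius are only dense. The gap is
  closed by continuity, once each Galois element is known to act on a finite subset of the closure
  as one power of Frobenius. The exponent has to serve the whole finite set; one depending on the
  element would not do.

  On the coarse side, vectors in one weighted orbit define the same prime ideal, but the converse
  fails: the parameter \<open>t\<close> plays the role of \<open>l ^ d\<close>, and it need not be a
  \<open>d\<close>-th power in the base field. Different \<open>l\<close> may also act in the same
  way on \<open>x\<close>. Counting parameters \<open>t\<close> instead of scalars \<open>l\<close>
  avoids both effects, because \<open>t\<close> can be recovered from the value of a Laurent
  monomial of degree \<open>d\<close>. This is also why the coarse count follows the number of
  vectors rather than the number of orbits.\<close>

locale idom_endo =
  fixes f :: "'b::idom \<Rightarrow> 'b"
  assumes add: "f (x + y) = f x + f y"
    and mult: "f (x * y) = f x * f y"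
    and one: "f 1 = 1"
begin

lemma zero: "f 0 = 0"
  by (metis add add_cancel_right_right add_0)

lemma uminus: "f (- x) = - f x"
  using add[of x "- x"] zero by (simp add: eq_neg_iff_add_eq_0 add.commute)

lemma sum: "f (sum g A) = (\<Sum>x\<in>A. f (g x))"
  by (induction A rule: infinite_finite_induct) (simp_all add: zero add)

lemma power: "f (x ^ n) = f x ^ n"
  by (induction n) (simp_all add: one mult)

lemma coeff_map: "coeff (map_poly f p) n = f (coeff p n)"
  by (simp add: coeff_map_poly zero)

text \<open>The locale asks only for an integral domain so that it can be entered again with
  polynomials: the orbit argument below is later applied to Frobenius acting on
  coefficients.\<close>

lemma map_poly_endo: "idom_endo (map_poly f)"
proof
  show "map_poly f (p + r) = map_poly f p + map_poly f r" for p r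
    by (rule poly_eqI) (simp add: coeff_map add)
  show "map_poly f (p * r) = map_poly f p * map_poly f r" for p r
    by (rule poly_eqI) (simp add: coeff_map coeff_mult sum mult)
  show "map_poly f 1 = 1"
    by (simp add: one)
qed

lemma map_poly_prod: "map_poly f (prod g A) = (\<Prod>x\<in>A. map_poly f (g x))"
proof -
  interpret p: idom_endo "map_poly f" by (rule map_poly_endo)
  show ?thesis
    by (induction A rule: infinite_finite_induct) (simp_all add: p.one p.mult)
qed

lemma poly_map: "poly (map_poly f p) (f x) = f (poly p x)"
  by (induction p) (simp_all add: map_poly_pCons zero add mult)

lemma funpow_endo: "idom_endo (f ^^ n)"
  by (induction n) (unfold_locales; simp add: idom_endo.add idom_endo.mult idom_endo.one add mult one)+

text \<open>The product of the \<open>Y - b\<close> over the \<open>f\<close>-orbit of \<open>a\<close> has \<open>f\<close>-invariant coefficients, so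
  \<open>g\<close> permutes its roots.\<close>

lemma agrees_with_iterate:
  assumes g: "idom_endo g"
    and fixed: "\<And>x. f x = x \<Longrightarrow> g x = x"
    and N: "0 < N" "(f ^^ N) a = a"
  shows "\<exists>i. g a = (f ^^ i) a"
proof -
  interpret g: idom_endo g by fact
  define B where "B = (\<lambda>i. (f ^^ i) a) ` {..<N}"
  have "a \<in> B"
    unfolding B_def using N(1) by (intro image_eqI[of _ _ 0]) auto
  have "b \<in> f ` B" if "b \<in> B" for b
  proof -
    obtain i where i: "i < N" "b = (f ^^ i) a" using \<open>b \<in> B\<close> by (auto simp: B_def)
    have "\<exists>j<N. b = f ((f ^^ j) a)"
    proof (cases i)
      case 0
      have "f ((f ^^ (N - 1)) a) = (f ^^ N) a" using N(1) by (cases N) auto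
      then show ?thesis using 0 i N by (intro exI[of _ "N - 1"]) auto
    next
      case (Suc j)
      then show ?thesis using i by (intro exI[of _ j]) auto
    qed
    then show ?thesis by (auto simp: B_def)
  qed
  then have sub: "B \<subseteq> f ` B" by blast
  have fin: "finite B" by (simp add: B_def)
  \<comment> \<open>A finite set contained in its image equals that image, by counting; the same
    count makes \<open>f\<close> injective on \<open>B\<close>.\<close>
  have img: "f ` B = B"
    using sub fin by (metis card_image_le card_seteq finite_imageI)
  have inj: "inj_on f B"
    using img fin by (simp add: eq_card_imp_inj_on)
  define Q where "Q = (\<Prod>b\<in>B. [:- b, 1:])"
  have "map_poly f Q = (\<Prod>b\<in>B. [:- f b, 1:])"
    by (simp add: Q_def map_poly_prod map_poly_pCons zero one uminus)
  also have "\<dots> = (\<Prod>b\<in>f ` B. [:- b, 1:])"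
    by (simp add: prod.reindex[OF inj])
  finally have "map_poly f Q = Q" by (simp add: img Q_def)
  then have "f (coeff Q n) = coeff Q n" for n
    by (metis coeff_map)
  then have "map_poly g Q = Q"
    by (intro poly_eqI) (simp add: g.coeff_map fixed)
  moreover have "poly Q a = 0"
    using \<open>a \<in> B\<close> fin by (simp add: Q_def poly_prod)
  ultimately have "poly Q (g a) = 0"
    by (metis g.poly_map g.zero)
  then have "g a \<in> B"
    using fin by (auto simp: Q_def poly_prod)
  then show ?thesis by (auto simp: B_def)
qed

end

section \<open>Frobenius on the algebraic closure\<close>

lemma finite_field_power_card:
  fixes x :: "'a::{field,finite}"
  shows "x ^ CARD('a) = x"
proof (cases "x = 0")
  case False
  \<comment> \<open>Multiplication by \<open>x\<close> permutes the nonzero elements, so their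
    product cancels and leaves \<open>x ^ (q - 1) = 1\<close>.\<close>
  have "bij_betw ((*) x) (- {0}) (- {0 :: 'a})"
    using False by (intro bij_betwI[of _ _ _ "\<lambda>y. y / x"]) auto
  then have "(\<Prod>y\<in>- {0}. x * y) = \<Prod>(- {0 :: 'a})"
    by (rule prod.reindex_bij_betw)
  then have "x ^ card (- {0 :: 'a}) = 1"
    by (simp add: prod.distrib)
  moreover have "Suc (card (- {0 :: 'a})) = CARD('a)"
    by (simp add: Compl_eq_Diff_UNIV card_Diff_singleton)
  ultimately show ?thesis
    by (metis mult.right_neutral power_Suc)
qed simp

definition frobenius :: "'a::{field,finite} alg_closure \<Rightarrow> 'a alg_closure" where
  "frobenius x = x ^ CARD('a)"

lemma card_field_gt_1: "1 < CARD('a::{field,finite})"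
  using card_mono[of UNIV "{0, 1 :: 'a}"] by simp

lemma frobenius_to_ac: "frobenius (to_ac c) = to_ac c"
  by (simp add: frobenius_def finite_field_power_card flip: to_ac_power)

text \<open>For fixed \<open>x\<close> the two sides are monic polynomials of degree \<open>q\<close> in \<open>y\<close>, so it is enough to
  compare them at the \<open>q\<close> elements of the base field.\<close>

lemma frobenius_add_aux:
  fixes x y :: "'a::{field,finite} alg_closure"
  assumes "\<And>a. frobenius (x + to_ac a) = frobenius x + to_ac a"
  shows "frobenius (x + y) = frobenius x + frobenius y"
proof -
  let ?q = "CARD('a)"
  have "[:x, 1:] ^ ?q = monom 1 ?q + [:x ^ ?q:]"
  proof (rule poly_eqI_degree_lead_coeff[of _ ?q _ "range to_ac"])
    show "coeff ([:x, 1:] ^ ?q) ?q = coeff (monom 1 ?q + [:x ^ ?q:]) ?q"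
      using card_field_gt_1[where ?'a = 'a]
      by (simp add: coeff_linear_power coeff_pCons split: nat.split)
    show "?q \<le> card (range (to_ac :: 'a \<Rightarrow> _))"
      by (simp add: card_image inj_to_ac)
    show "degree ([:x, 1:] ^ ?q) \<le> ?q"
      by (simp add: degree_linear_power)
    show "degree (monom 1 ?q + [:x ^ ?q:]) \<le> ?q"
      by (intro degree_add_le degree_monom_le) simp
    fix z :: "'a alg_closure" assume "z \<in> range to_ac"
    then obtain a where a: "z = to_ac a" by blast
    show "poly ([:x, 1:] ^ ?q) z = poly (monom 1 ?q + [:x ^ ?q:]) z"
      using assms[of a] frobenius_to_ac[of a]
      by (simp add: a frobenius_def poly_monom add.commute)
  qed
  then have "poly ([:x, 1:] ^ ?q) y = poly (monom 1 ?q + [:x ^ ?q:]) y"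
    by simp
  then show ?thesis
    by (simp add: frobenius_def poly_monom add.commute)
qed

text \<open>The auxiliary lemma is used twice. With a base field element as the fixed summand its
  hypothesis is \<open>c ^ q = c\<close> in the base field; the result, with the summands exchanged,
  is the hypothesis for arbitrary \<open>x\<close>. Neither the characteristic nor binomial
  coefficients enter.\<close>

lemma frobenius_add: "frobenius (x + y) = frobenius x + frobenius y"
proof (rule frobenius_add_aux)
  fix a
  have "frobenius (to_ac a + x) = frobenius (to_ac a) + frobenius x"
    by (rule frobenius_add_aux) (simp add: frobenius_to_ac flip: to_ac_add)
  then show "frobenius (x + to_ac a) = frobenius x + to_ac a"
    by (simp add: frobenius_to_ac add.commute)
qed

interpretation frobenius: idom_endo frobenius
  by unfold_locales (rule frobenius_add, simp_all add: frobenius_def power_mult_distrib)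

text \<open>The polynomial \<open>X ^ q - X\<close> has at most \<open>q\<close> roots, and the
  \<open>q\<close> elements of the base field are roots already.\<close>

lemma frobenius_fixed_iff: "frobenius x = x \<longleftrightarrow> x \<in> range (to_ac :: 'a::{field,finite} \<Rightarrow> _)"
proof
  assume "frobenius x = x"
  let ?q = "CARD('a)"
  let ?p = "monom 1 ?q - [:0, 1:] :: 'a alg_closure poly"
  have q: "1 < ?q" by (rule card_field_gt_1)
  have "coeff ?p ?q = 1"
    using q by (simp add: coeff_pCons split: nat.split)
  then have "?p \<noteq> 0" by fastforce
  then have fin: "finite {z. poly ?p z = 0}"
    by (rule poly_roots_finite)
  have "card {z. poly ?p z = 0} \<le> degree ?p"
    using \<open>?p \<noteq> 0\<close> by (rule card_poly_roots_bound)
  also have "\<dots> \<le> ?q"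
    using q by (intro degree_diff_le degree_monom_le) simp
  also have "\<dots> = card (range (to_ac :: 'a \<Rightarrow> _))"
    by (simp add: card_image inj_to_ac)
  finally have "card {z. poly ?p z = 0} \<le> card (range (to_ac :: 'a \<Rightarrow> _))" .
  moreover have "range to_ac \<subseteq> {z. poly ?p z = 0}"
    using frobenius_to_ac by (auto simp: poly_monom frobenius_def)
  ultimately have "range to_ac = {z. poly ?p z = 0}"
    using fin by (intro card_seteq)
  moreover have "poly ?p x = 0"
    using \<open>frobenius x = x\<close> by (simp add: poly_monom frobenius_def)
  ultimately show "x \<in> range to_ac" by blast
qed (auto simp: frobenius_to_ac)

lemma alg_closed_root_exists:
  fixes y :: "'a::alg_closed_field"
  assumes "0 < n"
  shows "\<exists>x. x ^ n = y"
proof -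
  have "coeff (monom 1 n - [:y:]) n = 1"
    using assms by (simp add: coeff_pCons split: nat.split)
  then have "n \<le> degree (monom 1 n - [:y:])"
    by (intro le_degree) simp
  then obtain x where "poly (monom 1 n - [:y:]) x = 0"
    using assms alg_closed_imp_poly_has_root by (metis less_le_trans)
  then show ?thesis by (auto simp: poly_monom)
qed

lemma bij_frobenius: "bij (frobenius :: 'a::{field,finite} alg_closure \<Rightarrow> _)"
proof (rule bijI)
  show "inj (frobenius :: 'a alg_closure \<Rightarrow> _)"
  proof (rule injI)
    fix x y :: "'a alg_closure" assume "frobenius x = frobenius y"
    then have "frobenius (x - y) = 0"
      using frobenius.add[of x "- y"] by (simp add: frobenius.uminus)
    then show "x = y" by (simp add: frobenius_def)
  qed
  show "surj (frobenius :: 'a alg_closure \<Rightarrow> _)"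
    unfolding surj_def
  proof
    fix y :: "'a alg_closure"
    obtain x where "x ^ CARD('a) = y"
      using alg_closed_root_exists[of "CARD('a)" y] by auto
    then show "\<exists>x. y = frobenius x"
      by (auto simp: frobenius_def)
  qed
qed

text \<open>Algebraicity of the closure enters here: the iterates of \<open>x\<close> stay among the
  finitely many roots of a polynomial over the base field, so two of them agree, and injectivity of
  Frobenius cancels the common initial iterates.\<close>

lemma frobenius_periodic:
  fixes x :: "'a::{field,finite} alg_closure"
  shows "\<exists>N>0. (frobenius ^^ N) x = x"
proof -
  obtain p :: "'a poly" where p: "p \<noteq> 0" "poly (map_poly to_ac p) x = 0"
    by (rule alg_closure_algebraic)
  let ?p = "map_poly to_ac p"
  have p': "map_poly frobenius ?p = ?p"
    by (rule poly_eqI) (simp add: coeff_map_poly frobenius.zero frobenius_to_ac)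
  have "poly ?p ((frobenius ^^ i) x) = 0" for i
  proof (induction i)
    case (Suc i)
    then show ?case
      using frobenius.poly_map[of ?p "(frobenius ^^ i) x"] by (simp add: p' frobenius.zero)
  qed (simp add: p)
  then have "range (\<lambda>i. (frobenius ^^ i) x) \<subseteq> {z. poly ?p z = 0}"
    by auto
  moreover have "finite {z. poly ?p z = 0}"
    using p(1) by (intro poly_roots_finite) (simp add: map_poly_eq_0_iff)
  ultimately have "finite (range (\<lambda>i. (frobenius ^^ i) x))"
    by (rule finite_subset)
  then have "\<not> inj (\<lambda>i. (frobenius ^^ i) x)"
    using finite_imageD by fastforce
  then obtain i j where ij: "(frobenius ^^ i) x = (frobenius ^^ j) x" "i < j"
    unfolding inj_on_def by (metis linorder_neqE_nat)
  then have "(frobenius ^^ i) ((frobenius ^^ (j - i)) x) = (frobenius ^^ i) x"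
    by (simp flip: funpow_add[THEN fun_cong, unfolded comp_apply])
  moreover have "inj (frobenius ^^ i :: 'a alg_closure \<Rightarrow> _)"
    using bij_frobenius bij_fn bij_is_inj by blast
  ultimately have "(frobenius ^^ (j - i)) x = x"
    by (auto dest: injD)
  with ij(2) show ?thesis by (intro exI[of _ "j - i"]) simp
qed

lemma funpow_mult_fixed: "(f ^^ N) x = x \<Longrightarrow> (f ^^ (N * k)) x = x"
  by (induction k) (simp_all add: funpow_add)

lemma frobenius_periodic_on:
  assumes "finite F"
  shows "\<exists>N>0. \<forall>x\<in>F. (frobenius ^^ N) x = x"
  using assms
proof induction
  case (insert x F)
  then obtain N where N: "N > 0" "\<forall>x\<in>F. (frobenius ^^ N) x = x" by blast
  obtain M where M: "M > 0" "(frobenius ^^ M) x = x" using frobenius_periodic by blast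
  have "(frobenius ^^ (N * M)) y = y" if "y \<in> insert x F" for y
  proof (cases "y = x")
    case True
    then show ?thesis using funpow_mult_fixed[OF M(2), of N] by (simp add: mult.commute)
  next
    case False
    then show ?thesis using that N funpow_mult_fixed[of N frobenius y M] by auto
  qed
  with N M show ?case by (intro exI[of _ "N * M"]) auto
qed auto

section \<open>Galois elements as powers of Frobenius on finite sets\<close>

lemma galois_group_iff:
  "s \<in> carrier galois_group \<longleftrightarrow> bij s \<and> idom_endo s \<and> (\<forall>c. s (to_ac c) = to_ac c)"
  by (auto simp: galois_group_def ring_iso_def ring_hom_def ring_of_type_algebra_def idom_endo_def)

lemma frobenius_in_galois: "frobenius ^^ i \<in> carrier galois_group"
proof -
  have "(frobenius ^^ i) (to_ac c) = to_ac c" for c :: 'a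
    by (induction i) (simp_all add: frobenius_to_ac)
  then show ?thesis
    by (simp add: galois_group_iff bij_frobenius bij_fn frobenius.funpow_endo)
qed

text \<open>A finite set is treated at once by taking its elements as the coefficients of a polynomial,
  on which the Galois group acts through the coefficients.\<close>

lemma galois_agrees_with_frobenius_power:
  assumes s: "s \<in> carrier galois_group" and "finite F"
  shows "\<exists>i. \<forall>a\<in>F. s a = (frobenius ^^ i) a"
proof -
  interpret s: idom_endo s using s by (simp add: galois_group_iff)
  obtain as where as: "set as = F" using \<open>finite F\<close> finite_list by blast
  define A where "A = Poly as"
  interpret \<Phi>: idom_endo "map_poly frobenius" by (rule frobenius.map_poly_endo)
  have iter: "coeff ((map_poly frobenius ^^ i) p) n = (frobenius ^^ i) (coeff p n)" for i n and p :: "'a alg_closure poly"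
    by (induction i) (simp_all add: frobenius.coeff_map)
  obtain N where N: "N > 0" "\<forall>x\<in>F. (frobenius ^^ N) x = x"
    using frobenius_periodic_on[OF \<open>finite F\<close>] by blast
  \<comment> \<open>\<open>Poly\<close> drops trailing zeros, but \<open>coeff\<close> returns 0
    there, so every list entry can still be read off; beyond the list the coefficient is 0 as well,
    which every endomorphism fixes.\<close>
  have A_coeff: "coeff A n = as ! n" if "n < length as" for n
    using that by (simp add: A_def nth_default_nth)
  have A_coeff0: "coeff A n = 0" if "n \<ge> length as" for n
    using that by (simp add: A_def nth_default_beyond)
  have "(map_poly frobenius ^^ N) A = A"
  proof (rule poly_eqI)
    fix n
    show "coeff ((map_poly frobenius ^^ N) A) n = coeff A n"
      using N as idom_endo.zero[OF frobenius.funpow_endo]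
      by (cases "n < length as") (auto simp: iter A_coeff A_coeff0)
  qed
  \<comment> \<open>The hypothesis of the orbit lemma: coefficients fixed by Frobenius lie in the
    base field, where \<open>s\<close> is the identity.\<close>
  moreover have "map_poly s p = p" if "map_poly frobenius p = p" for p
  proof (rule poly_eqI)
    fix n
    have "frobenius (coeff p n) = coeff p n"
      using that by (metis frobenius.coeff_map)
    then obtain c where "coeff p n = to_ac c"
      by (auto simp: frobenius_fixed_iff)
    then show "coeff (map_poly s p) n = coeff p n"
      using s by (simp add: s.coeff_map galois_group_iff)
  qed
  ultimately obtain i where i: "map_poly s A = (map_poly frobenius ^^ i) A"
    using \<Phi>.agrees_with_iterate[OF s.map_poly_endo _ N(1)] by blast
  have "s a = (frobenius ^^ i) a" if "a \<in> F" for a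
  proof -
    obtain n where n: "n < length as" "a = as ! n"
      using \<open>a \<in> F\<close> as by (metis in_set_conv_nth)
    then show ?thesis
      using arg_cong[OF i, of "\<lambda>p. coeff p n"] by (simp add: iter s.coeff_map A_coeff)
  qed
  then show ?thesis by blast
qed

section \<open>Torsors over a finite field\<close>

lemma carrier_Gm: "carrier (Gm :: 'b::field monoid) = - {0}"
  by (auto simp: units_of_def Units_def ring_of_type_algebra_def)
    (metis mult.commute nonzero_divide_eq_eq)

lemma Gm_mult: "x \<otimes>\<^bsub>Gm\<^esub> y = x * y" and Gm_one: "\<one>\<^bsub>Gm\<^esub> = 1"
  by (simp_all add: units_of_def ring_of_type_algebra_def)

lemma group_Gm: "group (Gm :: 'b::field monoid)"
proof -
  interpret field "ring_of_type_algebra :: 'b ring" by (rule field_from_type_algebra)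
  show ?thesis by (rule units_group)
qed

lemma galois_mult: "s \<otimes>\<^bsub>galois_group\<^esub> t = s \<circ> t" and galois_one: "\<one>\<^bsub>galois_group\<^esub> = id"
  by (simp_all add: galois_group_def)

lemma inv_in_galois:
  assumes "s \<in> carrier galois_group"
  shows "inv_into UNIV s \<in> carrier galois_group"
proof -
  interpret idom_endo s using assms by (simp add: galois_group_iff)
  have s: "bij s" "\<And>c. s (to_ac c) = to_ac c" using assms by (auto simp: galois_group_iff)
  have inj: "inj s" and s_inv: "s (inv_into UNIV s x) = x" for x
    using s(1) by (auto simp: bij_is_inj bij_is_surj surj_f_inv_f)
  have "idom_endo (inv_into UNIV s)"
    by unfold_locales (auto intro!: inv_f_eq[OF inj] simp: add mult one s_inv)
  moreover have "inv_into UNIV s (to_ac c) = to_ac c" for c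
    by (rule inv_f_eq[OF inj s(2)])
  ultimately show ?thesis
    using s(1) by (simp add: galois_group_iff bij_imp_bij_inv)
qed

lemma group_galois: "group (galois_group :: ('a::{field,finite} alg_closure \<Rightarrow> _) monoid)"
proof (rule groupI)
  fix s t :: "'a alg_closure \<Rightarrow> 'a alg_closure"
  assume s: "s \<in> carrier galois_group" and t: "t \<in> carrier galois_group"
  show "s \<otimes>\<^bsub>galois_group\<^esub> t \<in> carrier galois_group"
    using s t by (auto simp: galois_group_iff galois_mult bij_comp idom_endo_def)
next
  fix s :: "'a alg_closure \<Rightarrow> 'a alg_closure"
  assume s: "s \<in> carrier galois_group"
  then show "\<exists>t\<in>carrier galois_group. t \<otimes>\<^bsub>galois_group\<^esub> s = \<one>\<^bsub>galois_group\<^esub>"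
    by (intro bexI[OF _ inv_in_galois[OF s]])
      (simp add: galois_mult galois_one galois_group_iff bij_is_inj)
qed (auto simp: galois_group_iff galois_mult galois_one comp_assoc idom_endo_def)

text \<open>\<open>group_action\<close> means a homomorphism into \<open>BijGroup E\<close>, whose
  elements are extensional bijections. Bijectivity comes from the action of the inverse element, so
  only the pointwise laws remain to be checked.\<close>

lemma group_actionI:
  assumes G: "group G"
    and ext: "\<And>g. g \<in> carrier G \<Longrightarrow> \<phi> g \<in> extensional E"
    and closed: "\<And>g x. g \<in> carrier G \<Longrightarrow> x \<in> E \<Longrightarrow> \<phi> g x \<in> E"
    and comp: "\<And>g h x. g \<in> carrier G \<Longrightarrow> h \<in> carrier G \<Longrightarrow> x \<in> E \<Longrightarrow> \<phi> (g \<otimes>\<^bsub>G\<^esub> h) x = \<phi> g (\<phi> h x)"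
    and one: "\<And>x. x \<in> E \<Longrightarrow> \<phi> \<one>\<^bsub>G\<^esub> x = x"
  shows "group_action G E \<phi>"
proof -
  interpret group G by fact
  have Bij: "\<phi> g \<in> Bij E" if g: "g \<in> carrier G" for g
  proof -
    have "\<phi> (inv\<^bsub>G\<^esub> g) (\<phi> g x) = x" "\<phi> g (\<phi> (inv\<^bsub>G\<^esub> g) x) = x" if "x \<in> E" for x
      using that g one comp[of g "inv\<^bsub>G\<^esub> g" x] comp[of "inv\<^bsub>G\<^esub> g" g x] by auto
    then have "bij_betw (\<phi> g) E E"
      using g closed by (intro bij_betwI[of _ _ _ "\<phi> (inv\<^bsub>G\<^esub> g)"]) auto
    with ext[OF g] show ?thesis by (simp add: Bij_def)
  qed
  have "\<phi> (g \<otimes>\<^bsub>G\<^esub> h) = \<phi> g \<otimes>\<^bsub>BijGroup E\<^esub> \<phi> h" if gh: "g \<in> carrier G" "h \<in> carrier G" for g h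
  proof -
    have "\<phi> (g \<otimes>\<^bsub>G\<^esub> h) = compose E (\<phi> g) (\<phi> h)"
      using gh comp ext[of "g \<otimes>\<^bsub>G\<^esub> h"] by (intro extensionalityI[of _ E]) (auto simp: compose_def)
    then show ?thesis using gh Bij by (simp add: BijGroup_def)
  qed
  then have "\<phi> \<in> hom G (BijGroup E)"
    using Bij by (auto simp: hom_def BijGroup_def)
  then show ?thesis
    by (simp add: group_action_def group_hom_def group_hom_axioms_def G group_BijGroup)
qed

section \<open>Rational points of a torsor\<close>

definition rational_points :: "('a::field alg_closure, 'u) torsor \<Rightarrow> 'u set" where
  "rational_points T = {p \<in> geom_points T. \<forall>s\<in>carrier galois_group. tgal T s p = p}"

locale gm_torsor =
  fixes T :: "('a::{field,finite} alg_closure, 'u) torsor"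
  assumes is_torsor: "is_torsor T"
begin

sublocale gm: group_action Gm "geom_points T" "tact T"
  using is_torsor by (simp add: is_torsor_def)

sublocale gal: group_action galois_group "geom_points T" "tgal T"
  using is_torsor by (simp add: is_torsor_def)

lemma tact_closed: "l \<noteq> 0 \<Longrightarrow> p \<in> geom_points T \<Longrightarrow> tact T l p \<in> geom_points T"
  using gm.element_image by (simp add: carrier_Gm)

lemma tact_mult: "l \<noteq> 0 \<Longrightarrow> m \<noteq> 0 \<Longrightarrow> p \<in> geom_points T \<Longrightarrow> tact T (l * m) p = tact T l (tact T m p)"
  using gm.composition_rule[of p l m] by (simp add: carrier_Gm Gm_mult)

lemma tact_one: "p \<in> geom_points T \<Longrightarrow> tact T 1 p = p"
  using gm.id_eq_one by (metis Gm_one restrict_apply')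

lemma tgal_closed: "s \<in> carrier galois_group \<Longrightarrow> p \<in> geom_points T \<Longrightarrow> tgal T s p \<in> geom_points T"
  using gal.element_image by simp

lemma tgal_comp:
  "s \<in> carrier galois_group \<Longrightarrow> t \<in> carrier galois_group \<Longrightarrow> p \<in> geom_points T \<Longrightarrow>
    tgal T (s \<circ> t) p = tgal T s (tgal T t p)"
  using gal.composition_rule[of p s t] by (simp add: galois_mult)

lemma tgal_id: "p \<in> geom_points T \<Longrightarrow> tgal T id p = p"
  using gal.id_eq_one by (metis galois_one restrict_apply')

lemma tact_transitive:
  assumes "p \<in> geom_points T" "p' \<in> geom_points T"
  obtains l where "l \<noteq> 0" "tact T l p = p'"
proof -
  have "\<exists>!l. l \<in> carrier Gm \<and> tact T l p = p'"
    using is_torsor assms by (simp add: is_torsor_def)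
  then show ?thesis using that by (auto simp: carrier_Gm)
qed

lemma tact_inject:
  assumes "l \<noteq> 0" "m \<noteq> 0" "p \<in> geom_points T" "tact T l p = tact T m p"
  shows "l = m"
proof -
  have "\<exists>!k. k \<in> carrier Gm \<and> tact T k p = tact T l p"
    using is_torsor assms tact_closed by (simp add: is_torsor_def)
  then show ?thesis
    using assms by (auto simp: carrier_Gm)
qed

lemma tgal_tact:
  "s \<in> carrier galois_group \<Longrightarrow> l \<noteq> 0 \<Longrightarrow> p \<in> geom_points T \<Longrightarrow>
    tgal T s (tact T l p) = tact T (s l) (tgal T s p)"
  using is_torsor by (simp add: is_torsor_def carrier_Gm)

lemma continuous:
  assumes "p \<in> geom_points T"
  obtains F where "finite F"
    "\<And>s. s \<in> carrier galois_group \<Longrightarrow> (\<And>a. a \<in> F \<Longrightarrow> s a = a) \<Longrightarrow> tgal T s p = p"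
  using is_torsor assms unfolding is_torsor_def by metis

text \<open>Continuity gives a finite \<open>F\<close> whose pointwise stabilizer fixes
  \<open>p\<close>. If \<open>s\<close> agrees on \<open>F\<close> with a power \<open>f\<close> of
  Frobenius, then \<open>s\<close> is \<open>f\<close> composed with an element fixing
  \<open>F\<close> pointwise, and both factors fix \<open>p\<close>.\<close>

lemma frobenius_fixed_rational:
  assumes p: "p \<in> geom_points T" and fixed: "tgal T frobenius p = p"
  shows "p \<in> rational_points T"
proof -
  obtain F where F: "finite F"
    "\<And>s. s \<in> carrier galois_group \<Longrightarrow> (\<And>a. a \<in> F \<Longrightarrow> s a = a) \<Longrightarrow> tgal T s p = p"
    using continuous[OF p] by blast
  have pow: "tgal T (frobenius ^^ i) p = p" for i
  proof (induction i)
    case (Suc i)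
    then show ?case
      using tgal_comp[of frobenius "frobenius ^^ i" p] frobenius_in_galois[of 1] frobenius_in_galois[of i] p
      by (simp add: fixed comp_def)
  qed (use p tgal_id in \<open>simp add: id_def\<close>)
  have "tgal T s p = p" if s: "s \<in> carrier galois_group" for s
  proof -
    obtain i where i: "\<forall>a\<in>F. s a = (frobenius ^^ i) a"
      using galois_agrees_with_frobenius_power[OF s F(1)] by blast
    define f where "f = (frobenius ^^ i :: 'a alg_closure \<Rightarrow> _)"
    have bij: "bij f" by (simp add: f_def bij_frobenius bij_fn)
    have f: "f \<in> carrier galois_group" by (simp add: f_def frobenius_in_galois)
    have t: "inv_into UNIV f \<circ> s \<in> carrier galois_group"
      using group.is_monoid[OF group_galois] inv_in_galois[OF f] s monoid.m_closed
      by (metis galois_mult)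
    have "tgal T (inv_into UNIV f \<circ> s) p = p"
      using i bij by (intro F(2)[OF t]) (simp add: bij_is_inj flip: f_def)
    moreover have "s = f \<circ> (inv_into UNIV f \<circ> s)"
      using bij by (simp add: fun_eq_iff bij_is_surj surj_f_inv_f)
    moreover have "tgal T f p = p"
      using pow by (simp add: f_def)
    ultimately show ?thesis
      using tgal_comp[OF f t p] by simp
  qed
  with p show ?thesis by (simp add: rational_points_def)
qed

text \<open>Hilbert 90: if Frobenius moves \<open>p\<close> to \<open>l p\<close>, then \<open>m p\<close> is fixed as soon as
  \<open>m ^ (q - 1) = 1 / l\<close>.\<close>

lemma rational_points_nonempty: "rational_points T \<noteq> {}"
proof -
  have frob: "frobenius \<in> carrier galois_group"
    using frobenius_in_galois[of 1] by simp
  obtain p where p: "p \<in> geom_points T"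
    using is_torsor by (auto simp: is_torsor_def)
  then obtain l where l: "l \<noteq> 0" "tact T l p = tgal T frobenius p"
    using tact_transitive[OF p tgal_closed[OF frob p]] by blast
  obtain m where m: "m ^ (CARD('a) - 1) = inverse l"
    using alg_closed_root_exists[of "CARD('a) - 1" "inverse l"] card_field_gt_1[where ?'a = 'a] by auto
  with l card_field_gt_1[where ?'a = 'a] have "m \<noteq> 0"
    by (auto simp: power_0_left)
  have "frobenius m = m * inverse l"
    using card_field_gt_1[where ?'a = 'a] power_minus_mult[of "CARD('a)" m]
    by (simp add: frobenius_def mult.commute flip: m)
  then have "frobenius m * l = m" "frobenius m \<noteq> 0"
    using l \<open>m \<noteq> 0\<close> by simp_all
  then have "tgal T frobenius (tact T m p) = tact T m p"
    using tgal_tact[OF frob \<open>m \<noteq> 0\<close> p] tact_mult[of "frobenius m" l p] l p by simp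
  then show ?thesis
    using frobenius_fixed_rational tact_closed[OF \<open>m \<noteq> 0\<close> p] by blast
qed

text \<open>For a rational \<open>p\<close>, simple transitivity turns the invariance of
  \<open>l p\<close> under Frobenius into the invariance of the scalar \<open>l\<close>, which
  places \<open>l\<close> in the base field.\<close>

lemma rational_points_eq:
  assumes p: "p \<in> rational_points T"
  shows "rational_points T = (\<lambda>c. tact T (to_ac c) p) ` (- {0})"
proof (intro equalityI subsetI)
  have p': "p \<in> geom_points T" using p by (simp add: rational_points_def)
  fix r assume r: "r \<in> rational_points T"
  then obtain l where l: "l \<noteq> 0" "tact T l p = r"
    using tact_transitive[OF p'] by (auto simp: rational_points_def)
  have frob: "frobenius \<in> carrier galois_group"
    using frobenius_in_galois[of 1] by simp
  have "tact T (frobenius l) p = tact T l p"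
    using tgal_tact[OF frob l(1) p'] p r l(2) frob unfolding rational_points_def by force
  then have "frobenius l = l"
    using l(1) p' by (intro tact_inject[of _ _ p]) (simp_all add: frobenius_def)
  then show "r \<in> (\<lambda>c. tact T (to_ac c) p) ` (- {0})"
    using l by (auto simp: frobenius_fixed_iff)
next
  fix r assume "r \<in> (\<lambda>c. tact T (to_ac c) p) ` (- {0})"
  then show "r \<in> rational_points T"
    using p by (auto simp: rational_points_def tact_closed tgal_tact galois_group_iff)
qed

lemma card_rational_points: "card (rational_points T) = CARD('a) - 1"
proof -
  obtain p where p: "p \<in> rational_points T" using rational_points_nonempty by blast
  then have p': "p \<in> geom_points T" by (simp add: rational_points_def)
  have "inj_on (\<lambda>c. tact T (to_ac c) p) (- {0})"
  proof (rule inj_onI)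
    fix c d :: 'a
    assume "c \<in> - {0}" "d \<in> - {0}" "tact T (to_ac c) p = tact T (to_ac d) p"
    then have "to_ac c = to_ac d" by (intro tact_inject[OF _ _ p']) auto
    then show "c = d" by simp
  qed
  then show ?thesis
    unfolding rational_points_eq[OF p] by (simp add: card_image Compl_eq_Diff_UNIV card_Diff_singleton)
qed

lemma finite_rational_points: "finite (rational_points T)"
proof -
  obtain p where "p \<in> rational_points T" using rational_points_nonempty by blast
  then show ?thesis by (subst rational_points_eq) auto
qed

end

section \<open>Objects and morphisms in terms of rational points\<close>

lemma stack_objects_iff:
  "(T, f) \<in> stack_objects w \<longleftrightarrow> is_torsor T \<and>
     (\<forall>p\<in>geom_points T. (\<exists>i. f p i \<noteq> 0) \<and>
        (\<forall>l. l \<noteq> 0 \<longrightarrow> f (tact T l p) = weighted_act w l (f p)) \<and>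
        (\<forall>s\<in>carrier galois_group. f (tgal T s p) = s \<circ> f p))"
  by (auto simp: stack_objects_def carrier_Gm punctured_affine_def)

text \<open>A torsor is the orbit of any of its points, so an equivariant map is determined by the
  image of \<open>p\<close>. Galois equivariance makes that image rational. Conversely a rational
  \<open>r\<close> with the same value extends to \<open>l p -> l r\<close>, which commutes with the
  Galois action because \<open>p\<close> and \<open>r\<close> are both fixed.\<close>

lemma stack_hom_determined_by_rational_point:
  fixes T T' :: "('a::{field,finite} alg_closure, 'u) torsor"
  assumes obj: "(T, f) \<in> stack_objects w" "(T', f') \<in> stack_objects w"
    and p: "p \<in> rational_points T"
  shows "bij_betw (\<lambda>h. h p) (stack_hom (T, f) (T', f')) {p' \<in> rational_points T'. f' p' = f p}"
proof -
  interpret T: gm_torsor T using obj by unfold_locales (simp add: stack_objects_iff)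
  interpret T': gm_torsor T' using obj by unfold_locales (simp add: stack_objects_iff)
  have p': "p \<in> geom_points T" and p_fixed: "\<And>s. s \<in> carrier galois_group \<Longrightarrow> tgal T s p = p"
    using p by (auto simp: rational_points_def)
  have f: "f (tact T l r) = weighted_act w l (f r)" if "r \<in> geom_points T" "l \<noteq> 0" for r l
    using obj(1) that by (simp add: stack_objects_iff)
  have f': "f' (tact T' l r) = weighted_act w l (f' r)" if "r \<in> geom_points T'" "l \<noteq> 0" for r l
    using obj(2) that by (simp add: stack_objects_iff)
  show ?thesis
  proof (rule bij_betw_imageI)
    show "inj_on (\<lambda>h. h p) (stack_hom (T, f) (T', f'))"
    proof (rule inj_onI)
      fix h k assume h: "h \<in> stack_hom (T, f) (T', f')" and k: "k \<in> stack_hom (T, f) (T', f')"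
        and eq: "h p = k p"
      show "h = k"
      proof (rule extensionalityI[of _ "geom_points T"])
        show "h \<in> extensional (geom_points T)" "k \<in> extensional (geom_points T)"
          using h k by (auto simp: PiE_def)
        fix r assume "r \<in> geom_points T"
        then obtain l where l: "l \<noteq> 0" "tact T l p = r"
          using T.tact_transitive[OF p'] by blast
        then have "h r = tact T' l (h p)" "k r = tact T' l (k p)"
          using h k p' by (auto simp: carrier_Gm)
        then show "h r = k r" by (simp add: eq)
      qed
    qed
    show "(\<lambda>h. h p) ` stack_hom (T, f) (T', f') = {p' \<in> rational_points T'. f' p' = f p}"
    proof (intro equalityI subsetI)
      fix r assume "r \<in> (\<lambda>h. h p) ` stack_hom (T, f) (T', f')"
      then obtain h where h: "h \<in> stack_hom (T, f) (T', f')" "r = h p" by blast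
      have "tgal T' s (h p) = h p" if "s \<in> carrier galois_group" for s
        using h p' that p_fixed[OF that] by (auto dest!: bspec[of _ _ p])
      then show "r \<in> {p' \<in> rational_points T'. f' p' = f p}"
        using h p' by (auto simp: rational_points_def)
    next
      fix r assume r: "r \<in> {p' \<in> rational_points T'. f' p' = f p}"
      then have r': "r \<in> geom_points T'" and r_fixed: "\<And>s. s \<in> carrier galois_group \<Longrightarrow> tgal T' s r = r"
        and fr: "f' r = f p"
        by (auto simp: rational_points_def)
      \<comment> \<open>\<open>lab z\<close> is the scalar carrying \<open>p\<close> to
        \<open>z\<close>; it exists and is unique for \<open>z\<close> in the torsor, and only such
        \<open>z\<close> are used.\<close>
      define lab where "lab z = (SOME l. l \<noteq> 0 \<and> tact T l p = z)" for z
      have lab: "lab z \<noteq> 0" "tact T (lab z) p = z" if "z \<in> geom_points T" for z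
        using someI_ex[of "\<lambda>l. l \<noteq> 0 \<and> tact T l p = z"] T.tact_transitive[OF p' that]
        unfolding lab_def by blast+
      have labI: "lab z = l" if "l \<noteq> 0" "tact T l p = z" for l z
        using that lab[of z] T.tact_closed[OF _ p'] by (intro T.tact_inject[OF _ _ p']) auto
      define h where "h = (\<lambda>z\<in>geom_points T. tact T' (lab z) r)"
      have h: "h z = tact T' (lab z) r" if "z \<in> geom_points T" for z
        using that by (simp add: h_def)
      have hom: "h \<in> stack_hom (T, f) (T', f')"
        unfolding stack_hom.simps mem_Collect_eq
      proof (intro conjI ballI)
        show "h \<in> geom_points T \<rightarrow>\<^sub>E geom_points T'"
          by (auto simp: h_def T'.tact_closed lab r')
        fix z assume z: "z \<in> geom_points T"
        show "f' (h z) = f z"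
          using f[OF p' lab(1)[OF z]] f'[OF r' lab(1)[OF z]] lab(2)[OF z] by (simp add: h[OF z] fr)
        show "h (tact T l z) = tact T' l (h z)" if "l \<in> carrier Gm" for l
        proof -
          have l: "l \<noteq> 0" using that by (simp add: carrier_Gm)
          have "lab (tact T l z) = l * lab z"
            using l lab[OF z] T.tact_mult[OF l lab(1)[OF z] p'] by (intro labI) auto
          then show ?thesis
            using T'.tact_mult[OF l lab(1)[OF z] r'] T.tact_closed[OF l z] by (simp add: h z)
        qed
        show "h (tgal T s z) = tgal T' s (h z)" if s: "s \<in> carrier galois_group" for s
        proof -
          have s_lab: "s (lab z) \<noteq> 0"
          proof
            assume "s (lab z) = 0"
            moreover have "s 0 = 0" "inj s"
              using s idom_endo.zero bij_is_inj by (auto simp: galois_group_iff)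
            ultimately show False using lab(1)[OF z] by (metis injD)
          qed
          \<comment> \<open>Since \<open>p\<close> is fixed, applying \<open>s\<close> to
            \<open>l p\<close> gives \<open>s(l) p\<close>.\<close>
          have "lab (tgal T s z) = s (lab z)"
            using T.tgal_tact[OF s lab(1)[OF z] p'] s_lab lab(2)[OF z] p_fixed[OF s] by (intro labI) auto
          then show ?thesis
            using T'.tgal_tact[OF s lab(1)[OF z] r'] T.tgal_closed[OF s z] r_fixed[OF s] by (simp add: h z)
        qed
      qed
      have "lab p = 1"
        using T.tact_one[OF p'] by (intro labI) auto
      then have "h p = r"
        using T'.tact_one[OF r'] by (simp add: h p')
      with hom show "r \<in> (\<lambda>h. h p) ` stack_hom (T, f) (T', f')" by blast
    qed
  qed
qed

text \<open>This set is a complete isomorphism invariant of the object, and its size determines the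
  order of the automorphism group.\<close>

fun rational_values :: "('a::field, 'n, 'u) stack_object \<Rightarrow> ('n \<Rightarrow> 'a alg_closure) set" where
  "rational_values (T, f) = f ` rational_points T"

definition rational_vectors :: "('n \<Rightarrow> 'a::field alg_closure) set" where
  "rational_vectors = {x. (\<exists>i. x i \<noteq> 0) \<and> range x \<subseteq> range to_ac}"

text \<open>Only scalars of the base field act, although the coordinates are kept in the closure
  because the maps of stack objects take their values there.\<close>

definition base_orbit :: "('n \<Rightarrow> nat) \<Rightarrow> ('n \<Rightarrow> 'a::field alg_closure) \<Rightarrow> ('n \<Rightarrow> 'a alg_closure) set" where
  "base_orbit w x = (\<lambda>c. weighted_act w (to_ac c) x) ` (- {0})"

lemma weighted_act_mult: "weighted_act w (l * m) x = weighted_act w l (weighted_act w m x)"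
  by (simp add: weighted_act_def power_mult_distrib mult.assoc)

lemma weighted_act_1: "weighted_act w 1 x = x"
  by (simp add: weighted_act_def)

lemma rational_values_eq_base_orbit:
  fixes Z :: "('a::{field,finite}, 'n, 'u) stack_object"
  assumes Z: "Z \<in> stack_objects w" and x: "x \<in> rational_values Z"
  shows "rational_values Z = base_orbit w x"
proof -
  obtain T f where Tf: "Z = (T, f)" by (cases Z)
  interpret T: gm_torsor T using Z by unfold_locales (simp add: stack_objects_iff Tf)
  obtain p where p: "p \<in> rational_points T" "x = f p" using x by (auto simp: Tf)
  have "rational_values Z = (\<lambda>c. f (tact T (to_ac c) p)) ` (- {0})"
    by (simp add: Tf T.rational_points_eq[OF p(1)] image_image)
  also have "\<dots> = base_orbit w x"
    using Z p by (auto simp: base_orbit_def Tf stack_objects_iff rational_points_def intro!: image_cong)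
  finally show ?thesis .
qed

lemma rational_values_nonempty:
  assumes "Z \<in> stack_objects w"
  shows "\<exists>x. x \<in> rational_values (Z :: ('a::{field,finite}, 'n, 'u) stack_object)"
proof -
  obtain T f where Tf: "Z = (T, f)" by (cases Z)
  interpret T: gm_torsor T using assms by unfold_locales (simp add: stack_objects_iff Tf)
  show ?thesis using T.rational_points_nonempty by (auto simp: Tf)
qed

text \<open>At a rational point equivariance makes every coordinate invariant under
  Frobenius.\<close>

lemma rational_values_subset:
  fixes Z :: "('a::{field,finite}, 'n, 'u) stack_object"
  assumes Z: "Z \<in> stack_objects w"
  shows "rational_values Z \<subseteq> rational_vectors"
proof
  fix x assume "x \<in> rational_values Z"
  obtain T f where Tf: "Z = (T, f)" by (cases Z)
  obtain p where p: "p \<in> rational_points T" "x = f p"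
    using \<open>x \<in> rational_values Z\<close> by (auto simp: Tf)
  have frob: "frobenius \<in> carrier (galois_group :: ('a alg_closure \<Rightarrow> _) monoid)"
    using frobenius_in_galois[of 1] by simp
  have "f (tgal T frobenius p) = frobenius \<circ> f p"
    using Z p frob unfolding Tf stack_objects_iff rational_points_def by blast
  moreover have "tgal T frobenius p = p"
    using p frob unfolding rational_points_def by blast
  ultimately have "f p = frobenius \<circ> f p" by simp
  then have "frobenius (x i) = x i" for i
    using p by (metis comp_apply)
  moreover have "\<exists>i. x i \<noteq> 0"
    using Z p by (simp add: Tf stack_objects_iff rational_points_def)
  ultimately show "x \<in> rational_vectors"
    by (auto simp: rational_vectors_def frobenius_fixed_iff)
qed

text \<open>A morphism exists as soon as one value of \<open>Z\<close> occurs for \<open>Z'\<close>.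
  One common value is enough for equality, because both sets are the base orbit of that
  value.\<close>

lemma stack_hom_nonempty_iff:
  fixes Z Z' :: "('a::{field,finite}, 'n, 'u) stack_object"
  assumes Z: "Z \<in> stack_objects w" and Z': "Z' \<in> stack_objects w"
  shows "stack_hom Z Z' \<noteq> {} \<longleftrightarrow> rational_values Z = rational_values Z'"
proof -
  obtain T f where Tf: "Z = (T, f)" by (cases Z)
  obtain T' f' where Tf': "Z' = (T', f')" by (cases Z')
  obtain p where p: "p \<in> rational_points T"
    using rational_values_nonempty[OF Z] by (auto simp: Tf)
  have "stack_hom Z Z' \<noteq> {} \<longleftrightarrow> {p' \<in> rational_points T'. f' p' = f p} \<noteq> {}"
    using bij_betw_imp_surj_on[OF stack_hom_determined_by_rational_point[OF Z[unfolded Tf] Z'[unfolded Tf'] p]]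
    unfolding Tf Tf' by blast
  also have "\<dots> \<longleftrightarrow> f p \<in> rational_values Z'"
    by (auto simp: Tf' image_iff eq_commute)
  also have "\<dots> \<longleftrightarrow> rational_values Z = rational_values Z'"
  proof
    have fp: "f p \<in> rational_values Z" using p by (auto simp: Tf)
    show "rational_values Z = rational_values Z'" if "f p \<in> rational_values Z'"
      using rational_values_eq_base_orbit[OF Z fp] rational_values_eq_base_orbit[OF Z' that] by simp
    show "f p \<in> rational_values Z'" if "rational_values Z = rational_values Z'"
      using fp that by simp
  qed
  finally show ?thesis .
qed

text \<open>Orbit-stabilizer in fibre form: each nonempty fibre of \<open>f\<close> on the
  \<open>q - 1\<close> rational points is in bijection with the automorphisms, so all fibres have
  the same size.\<close>

lemma card_stack_aut:
  fixes Z :: "('a::{field,finite}, 'n, 'u) stack_object"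
  assumes Z: "Z \<in> stack_objects w"
  shows "finite (stack_aut Z)" and "card (stack_aut Z) * card (rational_values Z) = CARD('a) - 1"
proof -
  obtain T f where Tf: "Z = (T, f)" by (cases Z)
  interpret T: gm_torsor T using Z by unfold_locales (simp add: stack_objects_iff Tf)
  have bij: "bij_betw (\<lambda>h. h p) (stack_aut Z) {p' \<in> rational_points T. f p' = f p}"
    if "p \<in> rational_points T" for p
    using stack_hom_determined_by_rational_point Z that by (simp add: Tf)
  obtain p where "p \<in> rational_points T" using T.rational_points_nonempty by blast
  then show "finite (stack_aut Z)"
    using bij_betw_finite[OF bij] T.finite_rational_points by simp
  have "card (rational_points T) = (\<Sum>x\<in>f ` rational_points T. card {p' \<in> rational_points T. f p' = x})"
    using sum.image_gen[OF T.finite_rational_points, of "\<lambda>_. 1 :: nat" f] by simp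
  also have "\<dots> = (\<Sum>x\<in>f ` rational_points T. card (stack_aut Z))"
    by (rule sum.cong) (auto dest: bij_betw_same_card[OF bij])
  finally show "card (stack_aut Z) * card (rational_values Z) = CARD('a) - 1"
    by (simp add: T.card_rational_points Tf mult.commute)
qed

text \<open>The trivial torsor realizes \<open>x\<close>: its points are the units of the closure,
  copied into \<open>'u\<close> by the injection, and the map is \<open>l -> l . x\<close>, with
  value \<open>x\<close> at 1. It respects the Galois action because the coordinates of
  \<open>x\<close> lie in the base field. The size of the universe matters here.\<close>

lemma rational_vectors_subset_values:
  fixes universe :: "'a::{field,finite} alg_closure \<Rightarrow> 'u"
  assumes u: "inj universe" and x: "x \<in> rational_vectors"
  shows "\<exists>Z \<in> (stack_objects w :: ('a, 'n, 'u) stack_object set). x \<in> rational_values Z"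
proof -
  define v where "v = inv_into UNIV universe"
  have vu [simp]: "v (universe l) = l" for l
    using u by (simp add: v_def)
  define E where "E = universe ` (- {0})"
  define T where "T = \<lparr>geom_points = E,
    tact = (\<lambda>l. \<lambda>p\<in>E. universe (l * v p)), tgal = (\<lambda>s. \<lambda>p\<in>E. universe (s (v p)))\<rparr>"
  define f where "f p = weighted_act w (v p) x" for p
  have galD: "s 0 = 0" "inj s" "s (a * b) = s a * s b" "s 1 = 1" "s (to_ac c) = to_ac c"
    if "s \<in> carrier galois_group" for s :: "'a alg_closure \<Rightarrow> _" and a b c
    using that idom_endo.zero bij_is_inj by (auto simp: galois_group_iff idom_endo.mult idom_endo.one)
  have gal_nz: "s a \<noteq> 0" if "s \<in> carrier galois_group" "a \<noteq> 0" for s :: "'a alg_closure \<Rightarrow> _" and a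
    using galD[OF that(1)] that(2) by (metis injD)
  have "group_action Gm (geom_points T) (tact T)"
    by (rule group_actionI)
      (auto simp: T_def E_def carrier_Gm Gm_mult Gm_one mult.assoc intro: group_Gm)
  moreover have "group_action galois_group (geom_points T) (tgal T)"
    by (rule group_actionI)
      (auto simp: T_def E_def galois_mult galois_one gal_nz intro: group_galois)
  moreover have "\<exists>!l. l \<in> carrier Gm \<and> tact T l p = p'" if pp': "p \<in> geom_points T" "p' \<in> geom_points T" for p p'
  proof -
    obtain a b where "a \<noteq> 0" "b \<noteq> 0" "p = universe a" "p' = universe b"
      using pp' by (auto simp: T_def E_def)
    then show ?thesis
      by (intro ex1I[of _ "b / a"]) (auto simp: carrier_Gm T_def E_def inj_eq[OF u])
  qed
  \<comment> \<open>A point of the trivial torsor is a copy of an element of the closure, so fixing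
    this one element fixes the point.\<close>
  moreover have "\<exists>F. finite F \<and> (\<forall>s\<in>carrier galois_group. (\<forall>a\<in>F. s a = a) \<longrightarrow> tgal T s p = p)"
    if "p \<in> geom_points T" for p
    using that by (intro exI[of _ "{v p}"]) (auto simp: T_def E_def)
  moreover have "universe 1 \<in> geom_points T"
    by (simp add: T_def E_def)
  moreover have "tgal T s (tact T l p) = tact T (s l) (tgal T s p)"
    if "s \<in> carrier galois_group" "l \<in> carrier Gm" "p \<in> geom_points T" for s l p
    using that by (auto simp: T_def E_def carrier_Gm galD(3) gal_nz)
  ultimately have T: "is_torsor T"
    unfolding is_torsor_def by (intro conjI ballI) (blast+)
  have x_gal: "s (x i) = x i" if "s \<in> carrier galois_group" for s i
  proof -
    have "x i \<in> range to_ac" using x by (auto simp: rational_vectors_def)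
    then show ?thesis using galD(5)[OF that] by auto
  qed
  have x_nz: "\<exists>i. x i \<noteq> 0" using x by (auto simp: rational_vectors_def)
  have s_pow: "s (a ^ n) = s a ^ n" if "s \<in> carrier galois_group" for s :: "'a alg_closure \<Rightarrow> _" and a n
    using that by (simp add: galois_group_iff idom_endo.power)
  have obj: "(T, f) \<in> stack_objects w"
    unfolding stack_objects_iff
  proof (intro conjI ballI allI impI T)
    fix p assume "p \<in> geom_points T"
    then obtain a where a: "a \<noteq> 0" "p = universe a" by (auto simp: T_def E_def)
    show "\<exists>i. f p i \<noteq> 0"
      using x_nz a by (auto simp: f_def weighted_act_def)
    show "f (tact T l p) = weighted_act w l (f p)" if "l \<noteq> 0" for l
      using that a by (simp add: T_def E_def f_def weighted_act_mult)
    show "f (tgal T s p) = s \<circ> f p" if "s \<in> carrier galois_group" for s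
      using that a by (simp add: T_def E_def f_def weighted_act_def fun_eq_iff galD(3) s_pow x_gal)
  qed
  have "universe 1 \<in> rational_points T"
    by (auto simp: rational_points_def T_def E_def galD)
  moreover have "f (universe 1) = x" by (simp add: f_def weighted_act_1)
  ultimately have "x \<in> rational_values (T, f)" by force
  with obj show ?thesis by blast
qed

section \<open>The stacky mass\<close>

text \<open>The mass picks class representatives with \<open>SOME\<close>. When the relation is the
  kernel of \<open>S\<close>, the choice does not affect \<open>S\<close>, and a sum over classes
  can be reindexed over the values of \<open>S\<close>.\<close>

lemma kernel_quotient_bij:
  fixes S :: "'a \<Rightarrow> 'b"
  assumes R: "R = {(x, y). x \<in> A \<and> y \<in> A \<and> S x = S y}"
  shows "bij_betw (\<lambda>C. S (SOME x. x \<in> C)) (A // R) (S ` A)"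
    and "C \<in> A // R \<Longrightarrow> (SOME x. x \<in> C) \<in> A"
proof -
  have cls: "R `` {a} = {x \<in> A. S x = S a}" if "a \<in> A" for a
    using that by (auto simp: R)
  have rep: "(SOME x. x \<in> C) \<in> A" "S (SOME x. x \<in> C) = S a" if "a \<in> A" "C = R `` {a}" for a C
    using someI[of "\<lambda>x. x \<in> C" a] that cls by auto
  show "(SOME x. x \<in> C) \<in> A" if "C \<in> A // R"
    using that rep by (auto elim!: quotientE)
  show "bij_betw (\<lambda>C. S (SOME x. x \<in> C)) (A // R) (S ` A)"
  proof (rule bij_betw_imageI)
    show "inj_on (\<lambda>C. S (SOME x. x \<in> C)) (A // R)"
    proof (rule inj_onI, elim quotientE)
      fix C D a b
      assume "S (SOME x. x \<in> C) = S (SOME x. x \<in> D)" "C = R `` {a}" "a \<in> A" "D = R `` {b}" "b \<in> A"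
      then show "C = D" using rep(2)[of a C] rep(2)[of b D] by (simp add: cls)
    qed
    show "(\<lambda>C. S (SOME x. x \<in> C)) ` (A // R) = S ` A"
    proof -
      have "A // R = (\<lambda>a. R `` {a}) ` A"
        by (auto simp: quotient_def)
      then have "(\<lambda>C. S (SOME x. x \<in> C)) ` (A // R) = (\<lambda>a. S (SOME x. x \<in> R `` {a})) ` A"
        by (simp add: image_image)
      also have "\<dots> = S ` A"
        using rep(2) by (intro image_cong) auto
      finally show ?thesis .
    qed
  qed
qed

lemma card_punctured_affine: "card (punctured_affine :: ('n::finite \<Rightarrow> 'a::{field,finite}) set) = CARD('a) ^ CARD('n) - 1"
proof -
  have "punctured_affine = (UNIV :: ('n \<Rightarrow> 'a) set) - {\<lambda>_. 0}"
    by (auto simp: punctured_affine_def)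
  then show ?thesis
    using card_Diff_singleton[of "\<lambda>_. 0" "UNIV :: ('n \<Rightarrow> 'a) set"] by (simp add: card_fun)
qed

lemma rational_vectors_eq:
  "(rational_vectors :: ('n \<Rightarrow> 'a::field alg_closure) set) = (\<lambda>x. to_ac \<circ> x) ` punctured_affine"
proof (intro equalityI subsetI)
  fix x :: "'n \<Rightarrow> 'a alg_closure" assume x: "x \<in> rational_vectors"
  then have "x = to_ac \<circ> (of_ac \<circ> x)"
    by (auto simp: rational_vectors_def fun_eq_iff to_ac_of_ac image_subset_iff)
  moreover from this x have "of_ac \<circ> x \<in> punctured_affine"
    unfolding rational_vectors_def punctured_affine_def by auto (metis comp_apply to_ac_0)
  ultimately show "x \<in> (\<lambda>x. to_ac \<circ> x) ` punctured_affine" by blast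
qed (auto simp: rational_vectors_def punctured_affine_def)

lemma card_rational_vectors:
  "card (rational_vectors :: ('n::finite \<Rightarrow> 'a::{field,finite} alg_closure) set) = CARD('a) ^ CARD('n) - 1"
  and finite_rational_vectors: "finite (rational_vectors :: ('n::finite \<Rightarrow> 'a::{field,finite} alg_closure) set)"
proof -
  have "inj_on (\<lambda>x :: 'n \<Rightarrow> 'a. to_ac \<circ> x) punctured_affine"
    by (auto simp: inj_on_def fun_eq_iff)
  then show "card (rational_vectors :: ('n \<Rightarrow> 'a alg_closure) set) = CARD('a) ^ CARD('n) - 1"
    by (simp add: rational_vectors_eq card_image card_punctured_affine)
  show "finite (rational_vectors :: ('n \<Rightarrow> 'a alg_closure) set)"
    by (simp add: rational_vectors_eq)
qed

text \<open>Each summand is the size of a value set divided by \<open>q - 1\<close>. The value sets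
  are disjoint and cover all nonzero base vectors, so the weights, which only decide how vectors are
  grouped, drop out of the sum.\<close>

lemma stacky_mass_eq:
  fixes universe :: "'a::{field,finite} alg_closure \<Rightarrow> 'u" and w :: "'n::finite \<Rightarrow> nat"
  assumes u: "inj universe"
  shows "finite (stack_pi0 w :: ('a, 'n, 'u) stack_object set set)"
    and "stacky_mass TYPE('u) TYPE('a) w = (real CARD('a) ^ CARD('n) - 1) / (real CARD('a) - 1)"
proof -
  let ?q = "CARD('a)"
  let ?Ob = "stack_objects w :: ('a, 'n, 'u) stack_object set"
  let ?rep = "\<lambda>C :: ('a, 'n, 'u) stack_object set. SOME Z. Z \<in> C"
  have rel: "{(x, y). x \<in> ?Ob \<and> y \<in> ?Ob \<and> stack_hom x y \<noteq> {}}
      = {(x, y). x \<in> ?Ob \<and> y \<in> ?Ob \<and> rational_values x = rational_values y}"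
    using stack_hom_nonempty_iff by blast
  have bij: "bij_betw (\<lambda>C. rational_values (?rep C)) (stack_pi0 w) (rational_values ` ?Ob)"
    unfolding stack_pi0_def rel by (rule kernel_quotient_bij(1)[OF refl])
  have rep: "?rep C \<in> ?Ob" if "C \<in> stack_pi0 w" for C
    using that unfolding stack_pi0_def rel by (rule kernel_quotient_bij(2)[OF refl])
  have sub: "rational_values ` ?Ob \<subseteq> Pow rational_vectors"
    using rational_values_subset by blast
  then have fin: "finite (rational_values ` ?Ob)"
    by (rule finite_subset) (simp add: finite_rational_vectors)
  with bij show "finite (stack_pi0 w :: ('a, 'n, 'u) stack_object set set)"
    by (simp add: bij_betw_finite)
  have q: "1 < ?q" by (rule card_field_gt_1)
  have inv_aut: "1 / real (card (stack_aut Z)) = real (card (rational_values Z)) / (real ?q - 1)"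
    if "Z \<in> ?Ob" for Z
  proof -
    have "real (card (stack_aut Z)) * real (card (rational_values Z)) = real ?q - 1"
      using arg_cong[OF card_stack_aut(2)[OF that], of real] q by (simp add: of_nat_diff)
    moreover from this have "card (stack_aut Z) \<noteq> 0"
      using q by (intro notI) simp
    ultimately show ?thesis using q by (simp add: field_simps)
  qed
  have union: "\<Union> (rational_values ` ?Ob) = rational_vectors"
    using rational_values_subset rational_vectors_subset_values[OF u] by fastforce
  have disj: "rational_values Z = rational_values Z'"
    if "Z \<in> ?Ob" "Z' \<in> ?Ob" "x \<in> rational_values Z" "x \<in> rational_values Z'" for Z Z' x
    using rational_values_eq_base_orbit that by metis
  have "(\<Sum>B\<in>rational_values ` ?Ob. card B) = card (\<Union> (rational_values ` ?Ob))"
  proof (rule card_Union_disjoint[symmetric])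
    show "pairwise disjnt (rational_values ` ?Ob)"
      unfolding pairwise_def disjnt_def using disj by blast
    show "finite B" if "B \<in> rational_values ` ?Ob" for B
      using that sub finite_rational_vectors finite_subset by blast
  qed
  then have "real (\<Sum>B\<in>rational_values ` ?Ob. card B) = real ?q ^ CARD('n) - 1"
    using q by (simp only: union card_rational_vectors) (simp add: of_nat_diff)
  moreover have "stacky_mass TYPE('u) TYPE('a) w
      = (\<Sum>C\<in>stack_pi0 w. real (card (rational_values (?rep C))) / (real ?q - 1))"
    unfolding stacky_mass_def by (intro sum.cong refl inv_aut rep)
  moreover have "\<dots> = (\<Sum>B\<in>rational_values ` ?Ob. real (card B) / (real ?q - 1))"
    by (rule sum.reindex_bij_betw[OF bij, of "\<lambda>B. real (card B) / (real ?q - 1)"])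
  moreover have "\<dots> = real (\<Sum>B\<in>rational_values ` ?Ob. card B) / (real ?q - 1)"
    by (simp add: sum_divide_distrib)
  ultimately show "stacky_mass TYPE('u) TYPE('a) w = (real ?q ^ CARD('n) - 1) / (real ?q - 1)"
    by simp
qed

section \<open>Rational points of the coarse space\<close>

text \<open>Prime ideals in terms of the type class operations, so that congruences modulo
  \<open>P\<close> become ordinary ring arithmetic.\<close>

locale type_primeideal =
  fixes P :: "'r::comm_ring_1 set"
  assumes zero_mem: "0 \<in> P"
    and add_mem: "a \<in> P \<Longrightarrow> b \<in> P \<Longrightarrow> a + b \<in> P"
    and mult_mem: "a \<in> P \<Longrightarrow> r * a \<in> P"
    and one_notin: "1 \<notin> P"
    and prime: "a * b \<in> P \<Longrightarrow> a \<in> P \<or> b \<in> P"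
begin

lemma uminus_mem: "a \<in> P \<Longrightarrow> - a \<in> P"
  using mult_mem[of a "- 1"] by simp

lemma diff_mem: "a \<in> P \<Longrightarrow> b \<in> P \<Longrightarrow> a - b \<in> P"
  using add_mem[of a "- b"] uminus_mem by simp

lemma sum_mem: "(\<And>i. i \<in> A \<Longrightarrow> f i \<in> P) \<Longrightarrow> sum f A \<in> P"
  by (induction A rule: infinite_finite_induct) (auto simp: zero_mem add_mem)

lemma power_mem: "a ^ n \<in> P \<Longrightarrow> a \<in> P"
  by (induction n) (use one_notin prime in auto)

lemma prod_mem: "finite A \<Longrightarrow> prod f A \<in> P \<Longrightarrow> \<exists>i\<in>A. f i \<in> P"
  by (induction A rule: finite_induct) (use one_notin prime in auto)

lemma cong_mem_iff: "a - b \<in> P \<Longrightarrow> a \<in> P \<longleftrightarrow> b \<in> P"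
  using diff_mem[of a "a - b"] add_mem[of "a - b" b] by auto

lemma cong_mult: "a - b \<in> P \<Longrightarrow> c - d \<in> P \<Longrightarrow> a * c - b * d \<in> P"
  using add_mem[OF mult_mem[of "a - b" c] mult_mem[of "c - d" b]] by (simp add: algebra_simps)

lemma cong_power: "a - b \<in> P \<Longrightarrow> a ^ n - b ^ n \<in> P"
  by (induction n) (auto simp: zero_mem cong_mult)

lemma cong_prod: "(\<And>i. i \<in> A \<Longrightarrow> f i - g i \<in> P) \<Longrightarrow> prod f A - prod g A \<in> P"
  by (induction A rule: infinite_finite_induct) (auto simp: zero_mem cong_mult)

end

lemma primeideal_type_iff:
  "primeideal P (ring_of_type_algebra :: 'r::comm_ring_1 ring) \<longleftrightarrow> type_primeideal P"
proof
  let ?R = "ring_of_type_algebra :: 'r ring"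
  have ops: "carrier ?R = UNIV" "a \<otimes>\<^bsub>?R\<^esub> b = a * b" "a \<oplus>\<^bsub>?R\<^esub> b = a + b" "\<one>\<^bsub>?R\<^esub> = 1" "\<zero>\<^bsub>?R\<^esub> = 0" for a b
    by (simp_all add: ring_of_type_algebra_def)
  {
    assume "primeideal P ?R"
    then interpret primeideal P ?R .
    show "type_primeideal P"
    proof
      show "0 \<in> P" using additive_subgroup.zero_closed[OF is_additive_subgroup] by (simp add: ops)
      show "a + b \<in> P" if "a \<in> P" "b \<in> P" for a b
        using additive_subgroup.a_closed[OF is_additive_subgroup that] by (simp add: ops)
      show "r * a \<in> P" if "a \<in> P" for r a
        using I_l_closed[OF that] by (simp add: ops)
      show "1 \<notin> P"
        using I_notcarr one_imp_carrier by (auto simp: ops)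
      show "a \<in> P \<or> b \<in> P" if "a * b \<in> P" for a b
        using I_prime[of a b] that by (simp add: ops)
    qed
  }
  {
    assume "type_primeideal P"
    then interpret type_primeideal P .
    have R: "cring ?R" "ring ?R" by auto
    interpret cring ?R by (rule R)
    have minus: "\<ominus>\<^bsub>?R\<^esub> a = - a" for a
      by (rule sum_zero_eq_neg[symmetric]) (simp_all add: ops)
    show "primeideal P ?R"
    proof (rule primeidealI2)
      show "additive_subgroup P ?R"
      proof (intro additive_subgroup.intro add.subgroupI)
        show "\<ominus>\<^bsub>?R\<^esub> a \<in> P" if "a \<in> P" for a
          using minus[of a] uminus_mem[OF that] by simp
      qed (use zero_mem add_mem in \<open>auto simp: ops\<close>)
    qed (use R mult_mem one_notin prime in \<open>auto simp: ops mult.commute\<close>)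
  }
qed

section \<open>Weighted degrees and graded evaluation\<close>

lemma mpoly_eq_sum_single:
  "f = (\<Sum>m\<in>Poly_Mapping.keys f. Poly_Mapping.single m (Poly_Mapping.lookup f m))"
  by (rule poly_mapping_eqI)
    (simp add: lookup_sum lookup_single when_def in_keys_iff)

lemma wdeg_add: "wdeg w (m + m') = wdeg w m + wdeg w m'"
  by (simp add: wdeg_def lookup_add algebra_simps sum.distrib)

lemma wdeg_zero [simp]: "wdeg w 0 = 0"
  by (simp add: wdeg_def)

lemma wdeg_single [simp]: "wdeg w (Poly_Mapping.single i k) = w i * k"
proof -
  have "wdeg w (Poly_Mapping.single i k) = (\<Sum>j\<in>UNIV. if j = i then w i * k else 0)"
    unfolding wdeg_def by (rule sum.cong) (auto simp: lookup_single when_def)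
  then show ?thesis by simp
qed

lemma lookup_hom_component:
  "Poly_Mapping.lookup (hom_component w d f) m = (if wdeg w m = d then Poly_Mapping.lookup f m else 0)"
  by (auto simp: hom_component_def lookup_sum lookup_single when_def in_keys_iff)

lemma hom_component_of_homogeneous:
  "homogeneous w d f \<Longrightarrow> hom_component w e f = (if e = d then f else 0)"
  by (rule poly_mapping_eqI) (auto simp: lookup_hom_component homogeneous_def in_keys_iff)

lemma sum_hom_components:
  "f = (\<Sum>d\<in>wdeg w ` Poly_Mapping.keys f. hom_component w d f)"
proof -
  have "f = (\<Sum>m\<in>Poly_Mapping.keys f. Poly_Mapping.single m (Poly_Mapping.lookup f m))"
    by (rule mpoly_eq_sum_single)
  also have "\<dots> = (\<Sum>d\<in>wdeg w ` Poly_Mapping.keys f. hom_component w d f)"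
    unfolding hom_component_def by (rule sum.image_gen) simp
  finally show ?thesis .
qed

definition monom_eval :: "('n::finite \<Rightarrow> 'a::field) \<Rightarrow> ('n \<Rightarrow>\<^sub>0 nat) \<Rightarrow> 'a" where
  "monom_eval x m = (\<Prod>i\<in>UNIV. x i ^ Poly_Mapping.lookup m i)"

lemma monom_eval_add: "monom_eval x (m + m') = monom_eval x m * monom_eval x m'"
  by (simp add: monom_eval_def lookup_add power_add prod.distrib)

lemma monom_eval_zero [simp]: "monom_eval x 0 = 1"
  by (simp add: monom_eval_def)

lemma monom_eval_single [simp]: "monom_eval x (Poly_Mapping.single i k) = x i ^ k"
proof -
  have "monom_eval x (Poly_Mapping.single i k) = (\<Prod>j\<in>UNIV. if j = i then x i ^ k else 1)"
    unfolding monom_eval_def by (rule prod.cong) (auto simp: lookup_single when_def)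
  then show ?thesis by simp
qed

lemma monom_eval_eq_0_iff: "monom_eval x m = 0 \<longleftrightarrow> (\<exists>i\<in>Poly_Mapping.keys m. x i = 0)"
  by (auto simp: monom_eval_def in_keys_iff)

text \<open>The substitution of \<open>x\<^sub>i t ^ w\<^sub>i\<close> for the \<open>i\<close>-th variable; the coefficient of \<open>t ^ d\<close> is the
  value at \<open>x\<close> of the component of degree \<open>d\<close>.\<close>

definition graded_eval :: "('n::finite \<Rightarrow> nat) \<Rightarrow> ('n \<Rightarrow> 'a::field) \<Rightarrow> ('a, 'n) multipoly \<Rightarrow> 'a poly" where
  "graded_eval w x f =
     (\<Sum>m\<in>Poly_Mapping.keys f. monom (Poly_Mapping.lookup f m * monom_eval x m) (wdeg w m))"

lemma graded_eval_add: "graded_eval w x (f + g) = graded_eval w x f + graded_eval w x g"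
  unfolding graded_eval_def
  by (rule setsum_keys_plus_distrib) (simp_all add: add_monom algebra_simps)

lemma graded_eval_zero [simp]: "graded_eval w x 0 = 0"
  by (simp add: graded_eval_def)

lemma graded_eval_single [simp]:
  "graded_eval w x (Poly_Mapping.single m c) = monom (c * monom_eval x m) (wdeg w m)"
  by (simp add: graded_eval_def)

lemma graded_eval_sum: "graded_eval w x (sum f A) = (\<Sum>i\<in>A. graded_eval w x (f i))"
  by (induction A rule: infinite_finite_induct) (simp_all add: graded_eval_add)

lemma graded_eval_uminus: "graded_eval w x (- f) = - graded_eval w x f"
  using graded_eval_add[of w x f "- f"] by (simp add: eq_neg_iff_add_eq_0 add.commute)

lemma graded_eval_diff: "graded_eval w x (f - g) = graded_eval w x f - graded_eval w x g"
  using graded_eval_add[of w x f "- g"] by (simp add: graded_eval_uminus)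

lemma graded_eval_mult: "graded_eval w x (f * g) = graded_eval w x f * graded_eval w x g"
proof -
  let ?s = "\<lambda>f m. Poly_Mapping.single m (Poly_Mapping.lookup f m)"
  have "f * g = (\<Sum>m\<in>Poly_Mapping.keys f. ?s f m) * (\<Sum>m\<in>Poly_Mapping.keys g. ?s g m)"
    by (simp flip: mpoly_eq_sum_single)
  also have "\<dots> = (\<Sum>m\<in>Poly_Mapping.keys f. \<Sum>m'\<in>Poly_Mapping.keys g. ?s f m * ?s g m')"
    by (rule sum_product)
  finally have eq: "f * g = \<dots>" .
  have "graded_eval w x (f * g)
      = (\<Sum>m\<in>Poly_Mapping.keys f. \<Sum>m'\<in>Poly_Mapping.keys g.
          graded_eval w x (?s f m) * graded_eval w x (?s g m'))"
    unfolding eq graded_eval_sum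
    by (intro sum.cong refl) (simp add: mult_single mult_monom monom_eval_add wdeg_add mult_ac)
  then show ?thesis
    by (simp add: graded_eval_def[of w x f] graded_eval_def[of w x g] sum_product)
qed

lemma graded_eval_one [simp]: "graded_eval w x 1 = 1"
  by (simp flip: single_one)

lemma graded_eval_power: "graded_eval w x (f ^ n) = graded_eval w x f ^ n"
  by (induction n) (simp_all add: graded_eval_mult)

lemma coeff_graded_eval:
  "coeff (graded_eval w x f) d =
     (\<Sum>m\<in>{m \<in> Poly_Mapping.keys f. wdeg w m = d}. Poly_Mapping.lookup f m * monom_eval x m)"
  by (simp add: graded_eval_def coeff_sum sum.inter_filter)

lemma graded_eval_hom_component:
  "graded_eval w x (hom_component w d f) = monom (coeff (graded_eval w x f) d) d"
proof -
  have "graded_eval w x (hom_component w d f)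
      = (\<Sum>m\<in>{m \<in> Poly_Mapping.keys f. wdeg w m = d}. monom (Poly_Mapping.lookup f m * monom_eval x m) d)"
    unfolding hom_component_def graded_eval_sum by (rule sum.cong) auto
  then show ?thesis
    by (intro poly_eqI) (simp add: coeff_graded_eval coeff_sum)
qed

lemma graded_eval_homogeneous:
  assumes "homogeneous w d f"
  shows "graded_eval w x f = monom (coeff (graded_eval w x f) d) d"
  using graded_eval_hom_component[of w x d f] assms by (simp add: hom_component_of_homogeneous)

text \<open>The largest homogeneous ideal of polynomials vanishing at \<open>x\<close>. As the
  kernel of a ring homomorphism into the domain of polynomials in \<open>t\<close> it is
  prime.\<close>

definition point_ideal :: "('n::finite \<Rightarrow> nat) \<Rightarrow> ('n \<Rightarrow> 'a::field) \<Rightarrow> ('a, 'n) multipoly set" where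
  "point_ideal w x = {f. graded_eval w x f = 0}"

lemma prime_point_ideal: "type_primeideal (point_ideal w x)"
  by unfold_locales (auto simp: point_ideal_def graded_eval_add graded_eval_mult)

lemma homogeneous_single: "homogeneous w (wdeg w m) (Poly_Mapping.single m c)"
  by (simp add: homogeneous_def)

lemma var_in_irrelevant_ideal:
  assumes "0 < w i"
  shows "Poly_Mapping.single (Poly_Mapping.single i 1) 1 \<in> irrelevant_ideal w"
  using assms hom_component_of_homogeneous[OF homogeneous_single[of w "Poly_Mapping.single i 1" 1], of 0]
  by (simp add: irrelevant_ideal_def)

text \<open>This removes the quotient construction from rationality. Injectivity of the structure
  map is automatic, because a nonzero constant in \<open>P\<close> would be a unit; the right-hand
  side is its surjectivity.\<close>

lemma residue_field_eq_base_iff: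
  fixes P :: "('a::field, 'n::finite) multipoly set"
  assumes P: "type_primeideal P"
  shows "bij_betw (residue_const w P) UNIV (residue_field w P) \<longleftrightarrow>
    (\<forall>f g d. homogeneous w d f \<longrightarrow> homogeneous w d g \<longrightarrow> g \<notin> P \<longrightarrow>
       (\<exists>c. f - Poly_Mapping.single 0 c * g \<in> P))"
    (is "?bij \<longleftrightarrow> ?frac")
proof -
  interpret type_primeideal P by fact
  let ?F = "hom_fractions w P" and ?R = "residue_rel w P"
  let ?C = "Poly_Mapping.single 0 :: 'a \<Rightarrow> ('a, 'n) multipoly"
  have const: "(?C c, 1) \<in> ?F" for c
    using one_notin by (auto simp: hom_fractions_def homogeneous_def intro!: exI[of _ 0])
  have "trans_on ?F ?R"
  proof (rule trans_onI; clarify)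
    fix f g f' g' f'' g'' :: "('a, 'n) multipoly"
    assume "((f, g), (f', g')) \<in> ?R" "((f', g'), (f'', g'')) \<in> ?R"
    then have F: "(f, g) \<in> ?F" "(f', g') \<in> ?F" "(f'', g'') \<in> ?F"
      and "f * g' - f' * g \<in> P" "f' * g'' - f'' * g' \<in> P"
      by (auto simp: residue_rel_def)
    \<comment> \<open>The combination is a multiple of \<open>g'\<close>, which can be cancelled
      because \<open>P\<close> is prime and \<open>g'\<close> lies outside it.\<close>
    then have "g'' * (f * g' - f' * g) + g * (f' * g'' - f'' * g') \<in> P"
      by (intro add_mem mult_mem)
    then have "g' * (f * g'' - f'' * g) \<in> P"
      by (simp add: algebra_simps)
    then have "f * g'' - f'' * g \<in> P"
      using prime F by (auto simp: hom_fractions_def)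
    with F show "((f, g), (f'', g'')) \<in> ?R" by (simp add: residue_rel_def)
  qed
  moreover have "((f', g'), (f, g)) \<in> ?R" if "((f, g), (f', g')) \<in> ?R" for f g f' g'
    using that uminus_mem[of "f * g' - f' * g"] by (auto simp: residue_rel_def)
  ultimately have equiv: "equiv ?F ?R"
    by (intro equivI) (auto simp: refl_on_def residue_rel_def zero_mem trans_on_def sym_def)
  show ?thesis
  proof
    assume bij: ?bij
    show ?frac
    proof (intro allI impI)
      fix f g :: "('a, 'n) multipoly" and d assume "homogeneous w d f" "homogeneous w d g" "g \<notin> P"
      then have fg: "(f, g) \<in> ?F" by (auto simp: hom_fractions_def)
      then have "?R `` {(f, g)} \<in> residue_field w P"
        by (simp add: residue_field_def quotientI)
      then obtain c where "?R `` {(f, g)} = residue_const w P c"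
        using bij by (auto simp: bij_betw_def)
      then have "((?C c, 1), (f, g)) \<in> ?R"
        using equiv_class_self[OF equiv fg] by (auto simp: residue_const_def)
      then have "?C c * g - f \<in> P" by (simp add: residue_rel_def)
      then show "\<exists>c. f - ?C c * g \<in> P"
        using uminus_mem by fastforce
    qed
  next
    assume frac: ?frac
    show ?bij
    proof (rule bij_betw_imageI)
      show "inj (residue_const w P)"
      proof (rule injI, rule ccontr)
        fix c c' assume eq: "residue_const w P c = residue_const w P c'" and ne: "c \<noteq> c'"
        have "((?C c, 1), (?C c', 1)) \<in> ?R"
          using eq eq_equiv_class_iff[OF equiv const const] by (simp add: residue_const_def)
        then have "?C (c - c') \<in> P" by (simp add: residue_rel_def single_diff)
        then have "?C (1 / (c - c')) * ?C (c - c') \<in> P" by (rule mult_mem)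
        then show False using ne one_notin by (simp add: mult_single)
      qed
      show "range (residue_const w P) = residue_field w P"
      proof (intro equalityI subsetI)
        fix C assume "C \<in> residue_field w P"
        then obtain f g where fg: "(f, g) \<in> ?F" "C = ?R `` {(f, g)}"
          by (auto simp: residue_field_def elim!: quotientE)
        then obtain c where "f - ?C c * g \<in> P"
          using frac unfolding hom_fractions_def by blast
        then have "((f, g), (?C c, 1)) \<in> ?R"
          using fg const by (simp add: residue_rel_def)
        then have "C = residue_const w P c"
          using equiv_class_eq[OF equiv] fg by (simp add: residue_const_def)
        then show "C \<in> range (residue_const w P)" by blast
      qed (use const in \<open>auto simp: residue_const_def residue_field_def intro: quotientI\<close>)
    qed
  qed
qed

text \<open>Homogeneous \<open>f\<close> and \<open>g\<close> of degree \<open>d\<close> evaluate to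
  \<open>a t ^ d\<close> and \<open>b t ^ d\<close> with \<open>b\<close> nonzero, so the fraction
  is the constant \<open>a / b\<close>. A variable with nonzero coordinate has positive degree and
  shows that the irrelevant ideal is not contained.\<close>

lemma point_ideal_rational:
  fixes w :: "'n::finite \<Rightarrow> nat" and x :: "'n \<Rightarrow> 'a::field"
  assumes w: "\<forall>i. 0 < w i" and x: "x \<in> punctured_affine"
  shows "point_ideal w x \<in> Proj_rational_points w"
proof -
  interpret type_primeideal "point_ideal w x" by (rule prime_point_ideal)
  obtain i where i: "x i \<noteq> 0" using x by (auto simp: punctured_affine_def)
  have "Poly_Mapping.single (Poly_Mapping.single i 1) 1 \<notin> point_ideal w x"
    using i by (simp add: point_ideal_def)
  then have "\<not> irrelevant_ideal w \<subseteq> point_ideal w x"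
    using var_in_irrelevant_ideal w by blast
  moreover have "hom_component w d f \<in> point_ideal w x" if "f \<in> point_ideal w x" for f d
    using that by (simp add: point_ideal_def graded_eval_hom_component)
  moreover have "\<exists>c. f - Poly_Mapping.single 0 c * g \<in> point_ideal w x"
    if fg: "homogeneous w d f" "homogeneous w d g" "g \<notin> point_ideal w x" for f g d
  proof -
    obtain a b where ab: "graded_eval w x f = monom a d" "graded_eval w x g = monom b d"
      using graded_eval_homogeneous fg(1,2) by blast
    with fg(3) have "b \<noteq> 0" by (auto simp: point_ideal_def)
    then have "f - Poly_Mapping.single 0 (a / b) * g \<in> point_ideal w x"
      by (simp add: point_ideal_def graded_eval_diff graded_eval_mult ab mult_monom)
    then show ?thesis by blast
  qed
  ultimately show ?thesis
    unfolding Proj_rational_points_def Proj_def mem_Collect_eq primeideal_type_iff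
      residue_field_eq_base_iff[OF type_primeideal_axioms]
    using type_primeideal_axioms by blast
qed


text \<open>The positive generator of the group of degrees of Laurent monomials in the variables \<open>i \<in> I\<close>
  is the least positive difference of degrees of two monomials.\<close>

lemma degree_generator:
  fixes w :: "'n::finite \<Rightarrow> nat"
  assumes w: "\<forall>i. 0 < w i" and "i \<in> I"
  obtains d u v where "0 < d" "\<And>j. j \<in> I \<Longrightarrow> d dvd w j"
    "Poly_Mapping.keys u \<subseteq> I" "Poly_Mapping.keys v \<subseteq> I" "wdeg w u = wdeg w v + d"
proof -
  define M where "M = {wdeg w m | m. Poly_Mapping.keys m \<subseteq> I}"
  define Q where "Q d \<longleftrightarrow> 0 < d \<and> (\<exists>b\<in>M. b + d \<in> M)" for d
  have zero: "0 \<in> M"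
    unfolding M_def using wdeg_zero[of w] by (intro CollectI exI[of _ 0]) simp
  have add: "a + b \<in> M" if ab: "a \<in> M" "b \<in> M" for a b
  proof -
    obtain m m' where m: "a = wdeg w m" "Poly_Mapping.keys m \<subseteq> I"
        "b = wdeg w m'" "Poly_Mapping.keys m' \<subseteq> I"
      using ab by (auto simp: M_def)
    then show ?thesis
      unfolding M_def using keys_add[of m m'] by (intro CollectI exI[of _ "m + m'"]) (auto simp: wdeg_add)
  qed
  have mult: "k * a \<in> M" if "a \<in> M" for k a
    by (induction k) (use that zero add in auto)
  have gen: "w j \<in> M" if "j \<in> I" for j
    unfolding M_def using that by (intro CollectI exI[of _ "Poly_Mapping.single j 1"]) auto
  have "Q (w i)"
    unfolding Q_def using w gen[OF \<open>i \<in> I\<close>] zero by (intro conjI bexI[of _ 0]) auto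
  define d where "d = (LEAST d. Q d)"
  have "Q d" unfolding d_def using \<open>Q (w i)\<close> by (rule LeastI)
  then obtain b where b: "0 < d" "b \<in> M" "b + d \<in> M" by (auto simp: Q_def)
  have "d dvd w j" if "j \<in> I" for j
  proof (rule ccontr)
    assume "\<not> d dvd w j"
    then have "0 < w j mod d" by (simp add: dvd_eq_mod_eq_0)
    \<comment> \<open>Division with remainder: \<open>w j + ?k * b\<close> and
      \<open>?k * (b + d)\<close> are degrees of monomials that differ by \<open>w j mod d\<close>,
      a positive difference smaller than the least one.\<close>
    let ?k = "w j div d"
    have "?k * (b + d) + w j mod d = w j + ?k * b"
      by (simp add: algebra_simps)
    moreover have "w j + ?k * b \<in> M" "?k * (b + d) \<in> M"
      using gen[OF that] b mult add by auto
    ultimately have "Q (w j mod d)"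
      unfolding Q_def using \<open>0 < w j mod d\<close> by (intro conjI bexI[of _ "?k * (b + d)"]) auto
    then have "d \<le> w j mod d"
      unfolding d_def by (rule Least_le)
    moreover have "w j mod d < d" using b(1) by (rule mod_less_divisor)
    ultimately show False by simp
  qed
  moreover obtain u v where "b + d = wdeg w u" "Poly_Mapping.keys u \<subseteq> I" "b = wdeg w v" "Poly_Mapping.keys v \<subseteq> I"
    using b by (auto simp: M_def)
  ultimately show thesis using b(1) that[of d u v] by metis
qed

text \<open>Outside \<open>I\<close> the exponents of \<open>m\<close> are 0, so rounding in
  \<open>w i div d\<close> is harmless there. For \<open>d = 0\<close> both sides are 0.\<close>

lemma wdeg_div:
  assumes d: "\<And>i. i \<in> I \<Longrightarrow> d dvd w i" and m: "Poly_Mapping.keys m \<subseteq> I"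
  shows "wdeg w m div d = wdeg (\<lambda>i. w i div d) m"
proof (cases "d = 0")
  case False
  have "wdeg w m = (\<Sum>i\<in>UNIV. d * (w i div d * Poly_Mapping.lookup m i))"
    unfolding wdeg_def
  proof (rule sum.cong)
    fix i
    show "w i * Poly_Mapping.lookup m i = d * (w i div d * Poly_Mapping.lookup m i)"
      using d[of i] m by (cases "i \<in> I") (auto simp: in_keys_iff)
  qed simp
  then have "wdeg w m = d * wdeg (\<lambda>i. w i div d) m"
    by (simp add: wdeg_def sum_distrib_left)
  with False show ?thesis by simp
qed (simp add: wdeg_def)

section \<open>Vectors with the same point ideal\<close>

lemma monom_eval_weighted_act:
  "monom_eval (weighted_act k t x) m = t ^ wdeg k m * monom_eval x m"
  by (simp add: monom_eval_def weighted_act_def wdeg_def power_mult_distrib prod.distrib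
      power_sum power_mult)

text \<open>When \<open>d\<close> divides the weights on the support of \<open>x\<close>, this is
  the weighted action of a \<open>d\<close>-th root of \<open>t\<close>, expressed without choosing
  such a root, which may not exist in the base field.\<close>

abbreviation reduced_act :: "('n::finite \<Rightarrow> nat) \<Rightarrow> nat \<Rightarrow> 'a::field \<Rightarrow> ('n \<Rightarrow> 'a) \<Rightarrow> 'n \<Rightarrow> 'a" where
  "reduced_act w d \<equiv> weighted_act (\<lambda>i. w i div d)"

lemma monom_eval_reduced_act:
  assumes "\<And>i. x i \<noteq> 0 \<Longrightarrow> d dvd w i"
  shows "monom_eval (reduced_act w d t x) m = t ^ (wdeg w m div d) * monom_eval x m"
proof (cases "Poly_Mapping.keys m \<subseteq> {i. x i \<noteq> 0}")
  case True
  then have "wdeg w m div d = wdeg (\<lambda>i. w i div d) m"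
    using assms by (intro wdeg_div[of "{i. x i \<noteq> 0}"]) auto
  then show ?thesis by (simp add: monom_eval_weighted_act)
next
  case False
  then have "monom_eval x m = 0" by (auto simp: monom_eval_eq_0_iff)
  then show ?thesis by (simp add: monom_eval_weighted_act)
qed

text \<open>The value of the degree \<open>e\<close> component is multiplied by the unit
  \<open>t ^ (e div d)\<close>.\<close>

lemma point_ideal_reduced_act:
  assumes "\<And>i. x i \<noteq> 0 \<Longrightarrow> d dvd w i" and "t \<noteq> 0"
  shows "point_ideal w (reduced_act w d t x) = point_ideal w x"
proof -
  have "coeff (graded_eval w (reduced_act w d t x) f) e = t ^ (e div d) * coeff (graded_eval w x f) e" for f e
    unfolding coeff_graded_eval sum_distrib_left
    by (rule sum.cong) (auto simp: monom_eval_reduced_act[OF assms(1)] mult_ac)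
  then show ?thesis
    using assms(2) by (auto simp: point_ideal_def poly_eq_iff)
qed

text \<open>The Laurent monomial \<open>u / v\<close> has degree \<open>d\<close>, so acting by
  \<open>t\<close> multiplies its value by exactly \<open>t\<close>; comparing values recovers the
  parameter.\<close>

lemma reduced_act_inject:
  fixes x :: "'n::finite \<Rightarrow> 'a::field"
  assumes d: "0 < d" "\<And>i. x i \<noteq> 0 \<Longrightarrow> d dvd w i"
    and u: "Poly_Mapping.keys u \<subseteq> {i. x i \<noteq> 0}" "Poly_Mapping.keys v \<subseteq> {i. x i \<noteq> 0}"
    and deg: "wdeg w u = wdeg w v + d"
    and st: "s \<noteq> 0" "reduced_act w d s x = reduced_act w d t x"
  shows "s = t"
proof -
  have ne: "monom_eval x u \<noteq> 0" "monom_eval x v \<noteq> 0"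
    using u by (auto simp: monom_eval_eq_0_iff)
  have pow: "s ^ (wdeg w m div d) = t ^ (wdeg w m div d)" if "monom_eval x m \<noteq> 0" for m
  proof -
    have "monom_eval (reduced_act w d s x) m = s ^ (wdeg w m div d) * monom_eval x m"
      "monom_eval (reduced_act w d t x) m = t ^ (wdeg w m div d) * monom_eval x m"
      using d(2) by (simp_all add: monom_eval_reduced_act)
    then show ?thesis using st(2) that by simp
  qed
  have "s * s ^ (wdeg w v div d) = t * t ^ (wdeg w v div d)"
    using pow[OF ne(1)] d(1) by (simp add: deg)
  then show ?thesis
    using pow[OF ne(2)] st(1) power_not_zero[of s "wdeg w v div d"] by auto
qed

abbreviation mvar :: "'n \<Rightarrow> ('a::field, 'n::finite) multipoly" where
  "mvar i \<equiv> Poly_Mapping.single (Poly_Mapping.single i 1) 1"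

lemma mvar_in_point_ideal_iff: "mvar i \<in> point_ideal w x \<longleftrightarrow> x i = 0"
  by (simp add: point_ideal_def)

text \<open>The parameter can only be the value of the Laurent monomial \<open>u / v\<close> at
  \<open>y\<close> divided by its value at \<open>x\<close>. That it works in each coordinate is
  read off from a binomial in the common ideal.\<close>

lemma point_ideal_eq_imp_reduced_act:
  fixes x y :: "'n::finite \<Rightarrow> 'a::field"
  assumes d: "0 < d" "\<And>i. x i \<noteq> 0 \<Longrightarrow> d dvd w i"
    and u: "Poly_Mapping.keys u \<subseteq> {i. x i \<noteq> 0}" "Poly_Mapping.keys v \<subseteq> {i. x i \<noteq> 0}"
    and deg: "wdeg w u = wdeg w v + d"
    and eq: "point_ideal w y = point_ideal w x"
  shows "\<exists>t. t \<noteq> 0 \<and> y = reduced_act w d t x"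
proof -
  have supp: "y i = 0 \<longleftrightarrow> x i = 0" for i
    using mvar_in_point_ideal_iff eq by metis
  define xu xv yu yv where "xu = monom_eval x u" and "xv = monom_eval x v"
    and "yu = monom_eval y u" and "yv = monom_eval y v"
  have ne: "xu \<noteq> 0" "xv \<noteq> 0" "yu \<noteq> 0" "yv \<noteq> 0"
    using u by (auto simp: monom_eval_eq_0_iff supp xu_def xv_def yu_def yv_def)
  let ?t = "(yu * xv) / (yv * xu)"
  have "y i = ?t ^ (w i div d) * x i" for i
  proof (cases "x i = 0")
    case False
    define k where "k = w i div d"
    have k: "w i = k * d" using d(2)[OF False] by (simp add: k_def)
    let ?U = "Poly_Mapping.single u 1" and ?V = "Poly_Mapping.single v 1"
    \<comment> \<open>As \<open>w i = k * d\<close>, both terms have degree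
      \<open>k * wdeg w u\<close>. The coefficients are chosen to make the binomial vanish at
      \<open>x\<close>; its vanishing at \<open>y\<close> is the desired formula for
      \<open>y i\<close>.\<close>
    let ?F = "Poly_Mapping.single 0 (xu ^ k) * mvar i * ?V ^ k - Poly_Mapping.single 0 (x i * xv ^ k) * ?U ^ k"
    have F: "graded_eval w z ?F
        = monom (xu ^ k * z i * monom_eval z v ^ k - x i * xv ^ k * monom_eval z u ^ k) (k * wdeg w u)" for z
      by (simp add: graded_eval_diff graded_eval_mult graded_eval_power mult_monom monom_power deg k
          algebra_simps diff_monom)
    have "?F \<in> point_ideal w x"
      unfolding point_ideal_def mem_Collect_eq F by (simp add: xu_def xv_def)
    then have "?F \<in> point_ideal w y"
      by (simp only: eq)
    then have "graded_eval w y ?F = 0"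
      by (simp only: point_ideal_def mem_Collect_eq)
    then have "xu ^ k * y i * yv ^ k = x i * xv ^ k * yu ^ k"
      unfolding F by (simp add: yu_def yv_def)
    then show ?thesis
      using ne by (simp add: field_simps power_mult_distrib power_divide flip: k_def)
  qed (simp add: supp)
  moreover have "?t \<noteq> 0" using ne by simp
  ultimately show ?thesis
    by (intro exI[of _ ?t]) (auto simp: weighted_act_def fun_eq_iff)
qed

text \<open>The divisor \<open>d\<close> varies with the support of \<open>x\<close>, but the number
  of parameters \<open>t\<close> does not; this uniformity makes the coarse count independent of the
  weights.\<close>

lemma card_point_ideal_fibre:
  fixes w :: "'n::finite \<Rightarrow> nat" and x :: "'n \<Rightarrow> 'a::{field,finite}"
  assumes w: "\<forall>i. 0 < w i" and x: "x \<in> punctured_affine"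
  shows "card {y \<in> punctured_affine. point_ideal w y = point_ideal w x} = CARD('a) - 1"
proof -
  obtain i where i: "x i \<noteq> 0" using x by (auto simp: punctured_affine_def)
  then have "i \<in> {i. x i \<noteq> 0}" by simp
  then obtain d u v where d: "0 < d" and dvd: "\<And>j. j \<in> {i. x i \<noteq> 0} \<Longrightarrow> d dvd w j"
    and u: "Poly_Mapping.keys u \<subseteq> {i. x i \<noteq> 0}" "Poly_Mapping.keys v \<subseteq> {i. x i \<noteq> 0}"
    and deg: "wdeg w u = wdeg w v + d"
    using degree_generator[OF w, of i "{i. x i \<noteq> 0}" thesis] by simp
  have d: "0 < d" "\<And>j. x j \<noteq> 0 \<Longrightarrow> d dvd w j"
    using d dvd by simp_all
  have "{y \<in> punctured_affine. point_ideal w y = point_ideal w x} = (\<lambda>t. reduced_act w d t x) ` (- {0})"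
  proof (intro equalityI subsetI)
    fix y assume "y \<in> {y \<in> punctured_affine. point_ideal w y = point_ideal w x}"
    then show "y \<in> (\<lambda>t. reduced_act w d t x) ` (- {0})"
      using point_ideal_eq_imp_reduced_act[OF d u deg] by blast
  next
    fix y assume "y \<in> (\<lambda>t. reduced_act w d t x) ` (- {0})"
    then obtain t where t: "t \<noteq> 0" "y = reduced_act w d t x" by blast
    have "y \<in> punctured_affine"
      using i t by (auto simp: punctured_affine_def weighted_act_def intro!: exI[of _ i])
    moreover have "point_ideal w y = point_ideal w x"
      unfolding t(2) using d(2) t(1) by (rule point_ideal_reduced_act)
    ultimately show "y \<in> {y \<in> punctured_affine. point_ideal w y = point_ideal w x}" by blast
  qed
  moreover have "inj_on (\<lambda>t. reduced_act w d t x) (- {0})"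
    using reduced_act_inject[OF d u deg] by (intro inj_onI) auto
  ultimately show ?thesis
    by (simp add: card_image Compl_eq_Diff_UNIV card_Diff_singleton)
qed


section \<open>Every rational point of the coarse space comes from a vector\<close>

lemma monomial_eq_prod_mvar:
  fixes m :: "'n::finite \<Rightarrow>\<^sub>0 nat"
  shows "Poly_Mapping.single m (1 :: 'a::field) = (\<Prod>i\<in>UNIV. mvar i ^ Poly_Mapping.lookup m i)"
proof -
  have var_power: "mvar i ^ k = Poly_Mapping.single (Poly_Mapping.single i k) (1 :: 'a)" for i :: 'n and k
    by (induction k) (simp_all add: mult_single flip: single_add)
  have prod: "(\<Prod>i\<in>A. Poly_Mapping.single (g i) (1 :: 'a)) = Poly_Mapping.single (sum g A) 1"
    if "finite A" for A :: "'n set" and g :: "'n \<Rightarrow> 'n \<Rightarrow>\<^sub>0 nat"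
    using that by (induction A) (simp_all add: mult_single)
  have m: "(\<Sum>i\<in>UNIV. Poly_Mapping.single i (Poly_Mapping.lookup m i)) = m"
    by (rule poly_mapping_eqI) (simp add: lookup_sum lookup_single when_def)
  show ?thesis
    unfolding var_power prod[OF finite] m ..
qed

text \<open>With \<open>U\<close>, \<open>V\<close> monomials outside \<open>P\<close> such that \<open>deg U = deg V + d\<close>, rationality of \<open>P\<close> makes
  the degree zero Laurent monomials \<open>x\<^sub>i (V / U) ^ (w\<^sub>i / d)\<close> constant modulo \<open>P\<close>; these constants are
  the coordinates of the point.\<close>

lemma rational_imp_point_ideal:
  fixes w :: "'n::finite \<Rightarrow> nat" and P :: "('a::field, 'n) multipoly set"
  assumes w: "\<forall>i. 0 < w i" and P: "P \<in> Proj_rational_points w"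
  shows "\<exists>x\<in>punctured_affine. P = point_ideal w x"
proof -
  let ?C = "Poly_Mapping.single 0 :: 'a \<Rightarrow> ('a, 'n) multipoly"
  have prime_P: "type_primeideal P"
    using P by (simp add: Proj_rational_points_def Proj_def primeideal_type_iff)
  interpret type_primeideal P by fact
  have hom: "hom_component w d f \<in> P" if "f \<in> P" for f d
    using P that by (simp add: Proj_rational_points_def Proj_def)
  have const: "\<exists>c. f - ?C c * g \<in> P" if "homogeneous w d f" "homogeneous w d g" "g \<notin> P" for f g d
    using P that residue_field_eq_base_iff[OF prime_P] unfolding Proj_rational_points_def by blast
  define I where "I = {i. mvar i \<notin> P}"
  have monomial_mem_iff: "Poly_Mapping.single m 1 \<in> P \<longleftrightarrow> \<not> Poly_Mapping.keys m \<subseteq> I" for m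
  proof
    assume "Poly_Mapping.single m 1 \<in> P"
    then have "\<exists>i\<in>UNIV. mvar i ^ Poly_Mapping.lookup m i \<in> P"
      by (subst (asm) monomial_eq_prod_mvar) (rule prod_mem, auto)
    then obtain i where i: "mvar i ^ Poly_Mapping.lookup m i \<in> P" by blast
    then have "mvar i \<in> P" by (rule power_mem)
    then have "i \<notin> I" by (simp add: I_def)
    moreover have "i \<in> Poly_Mapping.keys m"
      unfolding in_keys_iff using i one_notin by (intro notI) simp
    ultimately show "\<not> Poly_Mapping.keys m \<subseteq> I" by blast
  next
    assume "\<not> Poly_Mapping.keys m \<subseteq> I"
    then obtain i where i: "Poly_Mapping.lookup m i \<noteq> 0" "mvar i \<in> P"
      unfolding I_def in_keys_iff[symmetric] by blast
    have "m = m - Poly_Mapping.single i 1 + Poly_Mapping.single i 1"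
      using i(1) by (intro poly_mapping_eqI) (auto simp: lookup_add lookup_minus lookup_single when_def)
    then have "Poly_Mapping.single m 1 = Poly_Mapping.single (m - Poly_Mapping.single i 1) 1 * mvar i"
      by (simp add: mult_single)
    then show "Poly_Mapping.single m 1 \<in> P"
      using mult_mem[OF i(2)] by metis
  qed
  \<comment> \<open>If all variables were in \<open>P\<close>, so would be every polynomial without
    constant term, hence the irrelevant ideal, which \<open>Proj\<close> excludes.\<close>
  have "I \<noteq> {}"
  proof
    assume "I = {}"
    then have monomial: "Poly_Mapping.single m c \<in> P" if "m \<noteq> 0" for m c
    proof -
      have "Poly_Mapping.single m 1 \<in> P"
        using that \<open>I = {}\<close> by (simp add: monomial_mem_iff)
      then have "?C c * Poly_Mapping.single m 1 \<in> P" by (rule mult_mem)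
      then show ?thesis by (simp add: mult_single)
    qed
    have "f \<in> P" if f: "f \<in> irrelevant_ideal w" for f
    proof -
      have "Poly_Mapping.lookup f 0 = 0"
        using f lookup_hom_component[of w 0 f 0] by (simp add: irrelevant_ideal_def)
      then have "(\<Sum>m\<in>Poly_Mapping.keys f. Poly_Mapping.single m (Poly_Mapping.lookup f m)) \<in> P"
        by (intro sum_mem monomial) (auto simp: in_keys_iff)
      then show ?thesis by (simp flip: mpoly_eq_sum_single)
    qed
    then show False
      using P by (auto simp: Proj_rational_points_def Proj_def)
  qed
  then obtain i0 where "i0 \<in> I" by blast
  then obtain d u v where d: "0 < d" "\<And>j. j \<in> I \<Longrightarrow> d dvd w j"
    and u: "Poly_Mapping.keys u \<subseteq> I" "Poly_Mapping.keys v \<subseteq> I"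
    and deg: "wdeg w u = wdeg w v + d"
    using degree_generator[OF w, of i0 I thesis] by simp
  define U V :: "('a, 'n) multipoly" where "U = Poly_Mapping.single u 1" and "V = Poly_Mapping.single v 1"
  have UV: "U ^ k \<notin> P" "V ^ k \<notin> P" for k
    using power_mem[of U k] power_mem[of V k] u monomial_mem_iff[of u] monomial_mem_iff[of v]
    unfolding U_def V_def by blast+
  have single_power: "Poly_Mapping.single m 1 ^ k = Poly_Mapping.single (\<Sum>j<k. m) (1 :: 'a)"
    for m :: "'n \<Rightarrow>\<^sub>0 nat" and k
    by (induction k) (simp_all add: mult_single add.commute)
  have wdeg_mult: "wdeg w (\<Sum>j<k. m) = k * wdeg w m" for m k
    by (induction k) (simp_all add: wdeg_add)
  \<comment> \<open>The clause on \<open>c = 0\<close> makes \<open>I\<close> the support of the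
    resulting vector. For \<open>i\<close> in \<open>I\<close> the constant is nonzero because the
    product of \<open>mvar i\<close> and a power of \<open>V\<close> stays outside the prime
    \<open>P\<close>.\<close>
  have "\<exists>c. mvar i * V ^ (w i div d) - ?C c * U ^ (w i div d) \<in> P \<and> (c = 0 \<longleftrightarrow> i \<notin> I)" for i
  proof (cases "i \<in> I")
    case True
    define k where "k = w i div d"
    have k: "w i = k * d" using d(2)[OF True] by (simp add: k_def)
    have "homogeneous w (k * wdeg w u) (U ^ k)"
      by (simp add: U_def single_power homogeneous_def wdeg_mult)
    moreover have "homogeneous w (k * wdeg w u) (mvar i * V ^ k)"
      by (simp add: V_def single_power homogeneous_def wdeg_mult mult_single wdeg_add deg k algebra_simps)
    ultimately obtain c where c: "mvar i * V ^ k - ?C c * U ^ k \<in> P"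
      using const UV by blast
    moreover have "c \<noteq> 0"
    proof
      assume "c = 0"
      then have "mvar i * V ^ k \<in> P" using c by simp
      then show False using prime UV True by (auto simp: I_def)
    qed
    ultimately show ?thesis using True unfolding k_def by blast
  next
    case False
    then have "V ^ (w i div d) * mvar i \<in> P" by (intro mult_mem) (simp add: I_def)
    with False show ?thesis by (intro exI[of _ 0]) (simp add: mult.commute)
  qed
  then obtain x where x: "\<And>i. mvar i * V ^ (w i div d) - ?C (x i) * U ^ (w i div d) \<in> P"
    and x_supp: "\<And>i. x i = 0 \<longleftrightarrow> i \<notin> I"
    by metis
  have C_power: "?C a ^ k = ?C (a ^ k)" for a k
    by (induction k) (simp_all add: mult_single)
  have C_prod: "(\<Prod>i\<in>A. ?C (g i)) = ?C (prod g A)" if "finite A" for A :: "'n set" and g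
    using that by (induction A) (simp_all add: mult_single)
  \<comment> \<open>The congruences for the variables are raised to the exponents of
    \<open>m\<close> and multiplied; the exponents of \<open>V\<close> and of \<open>U\<close> add
    up to \<open>wdeg w m div d\<close>.\<close>
  have monomial_cong: "Poly_Mapping.single m 1 * V ^ (wdeg w m div d)
      - ?C (monom_eval x m) * U ^ (wdeg w m div d) \<in> P" for m
  proof (cases "Poly_Mapping.keys m \<subseteq> I")
    case True
    define k where "k i = w i div d" for i
    have "(\<Prod>i\<in>UNIV. (mvar i * V ^ k i) ^ Poly_Mapping.lookup m i)
        - (\<Prod>i\<in>UNIV. (?C (x i) * U ^ k i) ^ Poly_Mapping.lookup m i) \<in> P"
      by (intro cong_prod cong_power) (use x in \<open>simp add: k_def\<close>)
    then have "Poly_Mapping.single m 1 * V ^ wdeg k m - ?C (monom_eval x m) * U ^ wdeg k m \<in> P"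
      by (simp add: power_mult_distrib prod.distrib C_power C_prod monom_eval_def wdeg_def power_sum
          monomial_eq_prod_mvar[of m] flip: power_mult)
    then show ?thesis
      using wdeg_div[of I d w m] d(2) True by (simp add: k_def[abs_def])
  next
    case False
    then have "V ^ (wdeg w m div d) * Poly_Mapping.single m 1 \<in> P"
      by (intro mult_mem) (simp add: monomial_mem_iff)
    moreover have "monom_eval x m = 0"
      using False x_supp by (auto simp: monom_eval_eq_0_iff)
    ultimately show ?thesis by (simp add: mult.commute)
  qed
  \<comment> \<open>All monomials of degree \<open>e\<close> carry the same powers of
    \<open>V\<close> and \<open>U\<close>, so their congruences can be summed. The powers lie
    outside \<open>P\<close> and cancel, and a constant lies in \<open>P\<close> only if it is
    0.\<close>
  have component_mem_iff: "hom_component w e f \<in> P \<longleftrightarrow> coeff (graded_eval w x f) e = 0" for f e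
  proof -
    let ?S = "{m \<in> Poly_Mapping.keys f. wdeg w m = e}" and ?l = "Poly_Mapping.lookup f"
    have "(\<Sum>m\<in>?S. ?C (?l m) * (Poly_Mapping.single m 1 * V ^ (wdeg w m div d)
        - ?C (monom_eval x m) * U ^ (wdeg w m div d))) \<in> P"
      by (intro sum_mem mult_mem monomial_cong)
    also have "(\<Sum>m\<in>?S. ?C (?l m) * (Poly_Mapping.single m 1 * V ^ (wdeg w m div d)
        - ?C (monom_eval x m) * U ^ (wdeg w m div d)))
        = (\<Sum>m\<in>?S. Poly_Mapping.single m (?l m) * V ^ (e div d)
            - ?C (?l m * monom_eval x m) * U ^ (e div d))"
      by (rule sum.cong) (auto simp: right_diff_distrib mult_single simp flip: mult.assoc)
    also have "\<dots> = hom_component w e f * V ^ (e div d)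
        - ?C (coeff (graded_eval w x f) e) * U ^ (e div d)"
    proof -
      have C_sum: "(\<Sum>m\<in>A. ?C (g m)) = ?C (sum g A)" if "finite A" for A :: "('n \<Rightarrow>\<^sub>0 nat) set" and g
        using that by (induction A) (simp_all add: single_add)
      show ?thesis
        by (simp add: sum_subtractf hom_component_def coeff_graded_eval C_sum flip: sum_distrib_right)
    qed
    finally have "hom_component w e f * V ^ (e div d) \<in> P
        \<longleftrightarrow> ?C (coeff (graded_eval w x f) e) * U ^ (e div d) \<in> P"
      by (rule cong_mem_iff)
    moreover have "hom_component w e f * V ^ (e div d) \<in> P \<longleftrightarrow> hom_component w e f \<in> P"
      using prime UV(2) mult_mem by (metis mult.commute)
    moreover have "?C c * U ^ (e div d) \<in> P \<longleftrightarrow> c = 0" for c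
    proof
      assume "?C c * U ^ (e div d) \<in> P"
      then have "?C c \<in> P" using prime UV by blast
      then have "?C (1 / c) * ?C c \<in> P" by (rule mult_mem)
      then show "c = 0" using one_notin by (cases "c = 0") (auto simp: mult_single)
    qed (simp add: zero_mem)
    ultimately show ?thesis by simp
  qed
  have "f \<in> P \<longleftrightarrow> f \<in> point_ideal w x" for f
  proof -
    have "f \<in> P \<longleftrightarrow> (\<forall>e. hom_component w e f \<in> P)"
      using hom sum_mem[of "wdeg w ` Poly_Mapping.keys f" "\<lambda>e. hom_component w e f"]
        sum_hom_components[of f w] by metis
    then show ?thesis by (simp add: component_mem_iff point_ideal_def poly_eq_iff)
  qed
  moreover have "x \<in> punctured_affine"
    using x_supp \<open>i0 \<in> I\<close> by (auto simp: punctured_affine_def)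
  ultimately show ?thesis by blast
qed

lemma card_Proj_rational_points:
  fixes w :: "'n::finite \<Rightarrow> nat"
  assumes w: "\<forall>i. 0 < w i"
  shows "card (Proj_rational_points w :: ('a::{field,finite}, 'n) multipoly set set) * (CARD('a) - 1)
    = card (punctured_affine :: ('n \<Rightarrow> 'a) set)"
proof -
  have img: "point_ideal w ` punctured_affine = (Proj_rational_points w :: ('a, 'n) multipoly set set)"
  proof (intro equalityI subsetI)
    fix P :: "('a, 'n) multipoly set" assume "P \<in> Proj_rational_points w"
    then show "P \<in> point_ideal w ` punctured_affine"
      using rational_imp_point_ideal[OF w] by (simp add: image_iff)
  qed (use point_ideal_rational[OF w] in auto)
  have "card (punctured_affine :: ('n \<Rightarrow> 'a) set)
      = (\<Sum>P\<in>point_ideal w ` punctured_affine. card {y \<in> punctured_affine :: ('n \<Rightarrow> 'a) set. point_ideal w y = P})"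
    using sum.image_gen[of "punctured_affine :: ('n \<Rightarrow> 'a) set" "\<lambda>_. 1 :: nat" "point_ideal w"] by simp
  also have "\<dots> = (\<Sum>P\<in>point_ideal w ` (punctured_affine :: ('n \<Rightarrow> 'a) set). CARD('a) - 1)"
    by (rule sum.cong) (auto simp: card_point_ideal_fibre[OF w])
  finally show ?thesis by (simp add: img)
qed

section \<open>The number of orbits\<close>

lemma orbits_eq_image: "orbits G E \<phi> = orbit G \<phi> ` E"
  by (auto simp: orbits_def)

lemma orbit_weighted_act:
  "orbit Gm (weighted_act w) x = (\<lambda>l. weighted_act w l x) ` (- {0})"
  by (auto simp: orbit_def carrier_Gm)

lemma orbit_count_card_minus_1:
  "orbit_count TYPE('a::{field,finite}) (\<lambda>_ :: 'n::finite. CARD('a) - 1)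
    = card (punctured_affine :: ('n \<Rightarrow> 'a) set)"
proof -
  let ?w = "\<lambda>_ :: 'n. CARD('a) - 1"
  have "l ^ (CARD('a) - 1) = 1" if "l \<noteq> 0" for l :: 'a
    using that power_minus_mult[of "CARD('a)" l] finite_field_power_card[of l] by simp
  then have "weighted_act ?w l x = x" if "l \<noteq> 0" for l and x :: "'n \<Rightarrow> 'a"
    using that by (simp add: weighted_act_def)
  then have orbit: "orbit Gm (weighted_act ?w) x = {x}" for x :: "'n \<Rightarrow> 'a"
    unfolding orbit_weighted_act using image_constant[of 1 "- {0 :: 'a}" x] by simp
  show ?thesis
    unfolding orbit_count_def orbits_eq_image orbit by (simp add: card_image)
qed

text \<open>With more than two elements there is a unit \<open>a\<close> other than 1. The constant
  vectors with entries 1 and \<open>a\<close> then share an orbit, so there are fewer orbits than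
  vectors.\<close>

lemma orbit_count_one_less:
  assumes "2 < CARD('a::{field,finite})"
  shows "orbit_count TYPE('a) (\<lambda>_ :: 'n::finite. 1) < card (punctured_affine :: ('n \<Rightarrow> 'a) set)"
proof -
  let ?w = "\<lambda>_ :: 'n. 1 :: nat" and ?E = "punctured_affine :: ('n \<Rightarrow> 'a) set"
  have "\<exists>a :: 'a. a \<noteq> 0 \<and> a \<noteq> 1"
  proof (rule ccontr)
    assume "\<not> ?thesis"
    then have "UNIV = {0, 1 :: 'a}" by auto
    then have "CARD('a) = card {0, 1 :: 'a}" by (rule arg_cong)
    then show False using assms by simp
  qed
  then obtain a :: 'a where a: "a \<noteq> 0" "a \<noteq> 1" by blast
  have orbit: "(\<lambda>_. a) \<in> orbit Gm (weighted_act ?w) (\<lambda>_ :: 'n. 1)"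
    using a by (auto simp: orbit_weighted_act weighted_act_def fun_eq_iff)
  have "orbit Gm (weighted_act ?w) (\<lambda>_. a) = orbit Gm (weighted_act ?w) (\<lambda>_ :: 'n. 1)"
  proof (intro equalityI subsetI)
    fix y assume "y \<in> orbit Gm (weighted_act ?w) (\<lambda>_. a)"
    then obtain l where "l \<noteq> 0" "y = weighted_act ?w l (\<lambda>_. a)"
      by (auto simp: orbit_weighted_act)
    then show "y \<in> orbit Gm (weighted_act ?w) (\<lambda>_. 1)"
      unfolding orbit_weighted_act using a
      by (intro image_eqI[of _ _ "l * a"]) (auto simp: weighted_act_def)
  next
    fix y :: "'n \<Rightarrow> 'a" assume "y \<in> orbit Gm (weighted_act ?w) (\<lambda>_. 1)"
    then obtain l where "l \<noteq> 0" "y = weighted_act ?w l (\<lambda>_. 1)"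
      by (auto simp: orbit_weighted_act)
    then show "y \<in> orbit Gm (weighted_act ?w) (\<lambda>_. a)"
      unfolding orbit_weighted_act using a
      by (intro image_eqI[of _ _ "l / a"]) (auto simp: weighted_act_def)
  qed
  moreover have "(\<lambda>_. a) \<in> ?E" "(\<lambda>_. 1) \<in> ?E" "(\<lambda>_ :: 'n. a) \<noteq> (\<lambda>_. 1)"
    using a by (auto simp: punctured_affine_def fun_eq_iff)
  ultimately have "\<not> inj_on (orbit Gm (weighted_act ?w)) ?E"
    unfolding inj_on_def by blast
  then have "card (orbit Gm (weighted_act ?w) ` ?E) \<noteq> card ?E"
    using eq_card_imp_inj_on[of ?E] by auto
  then show ?thesis
    using card_image_le[of ?E "orbit Gm (weighted_act ?w)"]
    by (simp add: orbit_count_def orbits_eq_image)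
qed

section \<open>Comparison of the mass, the coarse count and the orbit count\<close>

lemma coarse_count_eq:
  fixes w :: "'n::finite \<Rightarrow> nat"
  assumes w: "\<forall>i. 0 < w i"
  shows "real (coarse_count TYPE('a::{field,finite}) w) = (real CARD('a) ^ CARD('n) - 1) / (real CARD('a) - 1)"
proof -
  have q: "1 < CARD('a)" by (rule card_field_gt_1)
  have "coarse_count TYPE('a) w * (CARD('a) - 1) = CARD('a) ^ CARD('n) - 1"
    using card_Proj_rational_points[OF w, where ?'a = 'a]
    by (simp add: coarse_count_def card_punctured_affine)
  then have "real (coarse_count TYPE('a) w) * real (CARD('a) - 1) = real (CARD('a) ^ CARD('n) - 1)"
    by (metis of_nat_mult)
  then show ?thesis
    using q by (simp add: of_nat_diff field_simps)
qed

theorem proposition3p9: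
  fixes w :: "'n::finite \<Rightarrow> nat"
    and n q :: nat
    and universe :: "'a::{field,finite} alg_closure \<Rightarrow> 'u"
  assumes n: "CARD('n) = n + 1"
    and q: "CARD('a) = q"
    and w: "\<forall>i. 0 < w i"
    and universe: "inj universe"
  shows "finite (stack_pi0 w :: ('a, 'n, 'u) stack_object set set) \<and>
      (\<forall>x \<in> (stack_objects w :: ('a, 'n, 'u) stack_object set). finite (stack_aut x)) \<and>
      stacky_mass TYPE('u) TYPE('a) w = real (coarse_count TYPE('a) w) \<and>
      real (coarse_count TYPE('a) w) = (real q ^ (n + 1) - 1) / (real q - 1) \<and>
      (\<forall>(v :: 'n \<Rightarrow> nat) (v' :: 'n \<Rightarrow> nat). (\<forall>i. 0 < v i) \<longrightarrow> (\<forall>i. 0 < v' i) \<longrightarrow>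
         stacky_mass TYPE('u) TYPE('a) v = stacky_mass TYPE('u) TYPE('a) v' \<and>
         coarse_count TYPE('a) v = coarse_count TYPE('a) v') \<and>
      (2 < q \<longrightarrow> (\<exists>(v :: 'n \<Rightarrow> nat) (v' :: 'n \<Rightarrow> nat). (\<forall>i. 0 < v i) \<and> (\<forall>i. 0 < v' i) \<and>
         orbit_count TYPE('a) v \<noteq> orbit_count TYPE('a) v'))"
proof -
  have mass: "stacky_mass TYPE('u) TYPE('a) v = (real CARD('a) ^ CARD('n) - 1) / (real CARD('a) - 1)"
    for v :: "'n \<Rightarrow> nat"
    by (rule stacky_mass_eq(2)[OF universe])
  have coarse: "real (coarse_count TYPE('a) v) = (real CARD('a) ^ CARD('n) - 1) / (real CARD('a) - 1)"
    if "\<forall>i. 0 < v i" for v :: "'n \<Rightarrow> nat"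
    using that by (rule coarse_count_eq)
  have coarse_indep: "coarse_count TYPE('a) v = coarse_count TYPE('a) v'"
    if "\<forall>i. 0 < v i" "\<forall>i. 0 < v' i" for v v' :: "'n \<Rightarrow> nat"
    using coarse[OF that(1)] coarse[OF that(2)] by (metis of_nat_eq_iff)
  \<comment> \<open>The restriction is genuine: for \<open>q = 2\<close> the only unit is 1, so
    every orbit is a single vector whatever the weights.\<close>
  have orbits: "\<exists>(v :: 'n \<Rightarrow> nat) (v' :: 'n \<Rightarrow> nat). (\<forall>i. 0 < v i) \<and> (\<forall>i. 0 < v' i) \<and>
      orbit_count TYPE('a) v \<noteq> orbit_count TYPE('a) v'" if "2 < q"
  proof (intro exI conjI)
    show "orbit_count TYPE('a) (\<lambda>_ :: 'n. 1) \<noteq> orbit_count TYPE('a) (\<lambda>_ :: 'n. CARD('a) - 1)"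
      using orbit_count_one_less[where ?'a = 'a and ?'n = 'n] that
      unfolding orbit_count_card_minus_1 by (simp add: q)
  qed (use that in \<open>simp_all add: q\<close>)
  show ?thesis
  proof (intro conjI allI impI)
    show "finite (stack_pi0 w :: ('a, 'n, 'u) stack_object set set)"
      by (rule stacky_mass_eq(1)[OF universe])
    show "\<forall>x\<in>(stack_objects w :: ('a, 'n, 'u) stack_object set). finite (stack_aut x)"
      using card_stack_aut(1) by blast
    show "stacky_mass TYPE('u) TYPE('a) w = real (coarse_count TYPE('a) w)"
      by (simp only: mass coarse[OF w])
    show "real (coarse_count TYPE('a) w) = (real q ^ (n + 1) - 1) / (real q - 1)"
      by (simp only: coarse[OF w] n q)
  qed (simp only: mass, rule coarse_indep, assumption+, rule orbits)
qed

end
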